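(* Let $\mathcal{O}_{-11}=\mathbb{Z}[\omega]$, $\omega=(-1+\sqrt{-11})/2$, and let $p$ be an odd rational prime which is inert in $\mathcal{O}_{-11}$. Let $\mathrm{P}\Gamma=\mathrm{P}\Gamma_0(p)\subset\mathrm{PSL}_2(\mathcal{O}_{-11})$ be the congruence subgroup of elements with lower left entry in $\langle p\rangle$. Let $\mathcal{S}_{\langle p\rangle}$ be the collection consisting of the spheres of radius $1/p$ centered at $\alpha/p$ for $\alpha\in\mathcal{O}_{-11}\setminus\langle p\rangle$, together with the isometric spheres (of radius $1/(p\sqrt3)$) of $\begin{pmatrix} 1 & 0 \\ p\omega & 1 \end{pmatrix}$, $\begin{pmatrix} 1 & 0 \\ p(\omega+1) & 1 \end{pmatrix}$ and their inverses, and the translates of these by $\mathrm{P}\Gamma_\infty$. Then: (1) The spheres of $\mathcal{S}_{\langle p\rangle}$ suffice to determine the boundary of the region $B$ exterior to all isometric spheres of $\mathrm{P}\Gamma_0(p)$, i.e. $B$ is the region exterior to all spheres of $\mathcal{S}_{\langle p\rangle}$. (2) A Ford fundamental domain for $\mathrm{P}\Gamma_0(p)$ is given by the union of the hyperbolic convex hull of the cusps $0$, $\infty$ and the points of $\mathbb{H}^3$ above $\pm z_1/p,\pm z_2/p,\pm z_3/p$ at height $\sqrt{2/(11p^2)}$, and, for all integers $j,k$ with $-(p-1)/2\le j,k\le(p-1)/2$ and $j,k$ not both $0$, the convex hull of $\infty$ and the points above $(\pm z_1+j+k\omega)/p$, $(\pm z_2+j+k\omega)/p$, $(\pm z_3+j+k\omega)/p$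 at height $\sqrt{2/(11p^2)}$.
   Context: $\mathbb{H}^3$ is upper half-space over $\mathbb{C}$. For $\gamma=\begin{pmatrix} a & b \\ c & d \end{pmatrix}\in\mathrm{PSL}_2(\mathbb{C})$ with $c\neq0$, the isometric sphere $S_\gamma$ is the hemisphere with center $-d/c$ and radius $1/|c|$. For a discrete group $\mathrm{P}\Gamma$, $\mathrm{P}\Gamma_\infty$ is the subgroup of elements fixing $\infty$; a Ford fundamental domain for $\mathrm{P}\Gamma$ is the intersection of the region $B\subset\mathbb{H}^3$ exterior to all isometric spheres of elements of $\mathrm{P}\Gamma$ with a fundamental domain for the action of $\mathrm{P}\Gamma_\infty$. $z_1=\frac{3}{11}+\frac{6\omega}{11}=\frac{3i}{\sqrt{11}}$, $z_2=-\frac{3}{11}+\frac{5\omega}{11}=-\frac12+\frac{5i}{2\sqrt{11}}$, $z_3=\frac{8}{11}+\frac{5\omega}{11}=\frac12+\frac{5i}{2\sqrt{11}}$. *)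

theory Defs
  imports "HOL-Algebra.Ideal" "HOL-Analysis.Analysis"
begin

subsection \<open>Upper half-space and its ideal boundary\<close>

definition H3 :: "(complex \<times> real) set" where
  "H3 = {(z, t). t > 0}"

text \<open>Points of the closure of upper half-space are elements of \<^typ>\<open>(complex \<times> real) option\<close>:
  \<^term>\<open>None\<close> is the ideal point at infinity, \<^term>\<open>Some (z, 0)\<close> the ideal point
  \<^term>\<open>z\<close>, and \<^term>\<open>Some (z, t)\<close> with \<^term>\<open>t > 0\<close> the point at height \<^term>\<open>t\<close>
  above \<^term>\<open>z\<close>.\<close>

type_synonym ext_point = "(complex \<times> real) option"

definition mat2 :: "complex \<Rightarrow> complex \<Rightarrow> complex \<Rightarrow> complex \<Rightarrow> complex^2^2" where
  "mat2 a b c d = vector [vector [a, b], vector [c, d]]"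

text \<open>The Poincare extension of the Moebius transformation of a matrix of determinant 1.\<close>

definition mat_act :: "complex^2^2 \<Rightarrow> complex \<times> real \<Rightarrow> complex \<times> real" where
  "mat_act M = (\<lambda>(z, t).
     let a = M$1$1; b = M$1$2; c = M$2$1; d = M$2$2;
         n = (cmod (c * z + d))\<^sup>2 + (cmod c)\<^sup>2 * t\<^sup>2
     in (((a * z + b) * cnj (c * z + d) + a * cnj c * of_real (t\<^sup>2)) / of_real n, t / n))"

definition mat_ext_act :: "complex^2^2 \<Rightarrow> ext_point \<Rightarrow> ext_point" where
  "mat_ext_act M P =
     (case P of
        None \<Rightarrow> if M$2$1 = 0 then None else Some (M$1$1 / M$2$1, 0)
      | Some (z, t) \<Rightarrow>
          if t = 0 \<and> M$2$1 * z + M$2$2 = 0 then None else Some (mat_act M (z, t)))"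

text \<open>The hemisphere with Euclidean centre \<^term>\<open>(z, 0)\<close> and Euclidean radius \<^term>\<open>r\<close>
  (the norm on \<^typ>\<open>complex \<times> real\<close> is the Euclidean one).\<close>

definition hemisphere :: "complex \<Rightarrow> real \<Rightarrow> (complex \<times> real) set" where
  "hemisphere z r = H3 \<inter> sphere (z, 0) r"

text \<open>The isometric sphere; only meaningful for \<^term>\<open>M$2$1 \<noteq> 0\<close>.\<close>

definition mat_isometric_sphere :: "complex^2^2 \<Rightarrow> (complex \<times> real) set" where
  "mat_isometric_sphere M = hemisphere (- M$2$2 / M$2$1) (1 / cmod (M$2$1))"

subsection \<open>The group of complex 2 by 2 matrices of determinant 1 modulo sign\<close>

definition psl_rel :: "complex^2^2 \<Rightarrow> complex^2^2 \<Rightarrow> bool" where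
  "psl_rel M N \<longleftrightarrow> det M = 1 \<and> det N = 1 \<and> (N = M \<or> N = - M)"

lemma part_equivp_psl_rel: "part_equivp psl_rel"
proof (rule part_equivpI)
  have "psl_rel (mat 1) (mat 1)"
    by (simp add: psl_rel_def)
  then show "\<exists>M. psl_rel M M" by blast
  show "symp psl_rel" by (auto simp: symp_def psl_rel_def)
  show "transp psl_rel" by (auto simp: transp_def psl_rel_def)
qed

quotient_type psl2c = "complex^2^2" / partial: psl_rel
  by (rule part_equivp_psl_rel)

lemma mat_act_minus: "mat_act (- M) = mat_act M"
proof
  fix x :: "complex \<times> real"
  obtain z t where x: "x = (z, t)" by (cases x)
  have "- (M$2$1 * z) - M$2$2 = - (M$2$1 * z + M$2$2)"
       "- (M$1$1 * z) - M$1$2 = - (M$1$1 * z + M$1$2)"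
    by simp_all
  then show "mat_act (- M) x = mat_act M x"
    unfolding x mat_act_def Let_def
    by (simp only: case_prod_conv vector_uminus_component minus_add_distrib [symmetric]
        mult_minus_left mult_minus_right norm_minus_cancel complex_cnj_minus minus_minus)
qed

lemma mat_ext_act_minus: "mat_ext_act (- M) = mat_ext_act M"
proof
  fix P
  have "- (M$2$1 * z) - M$2$2 = 0 \<longleftrightarrow> M$2$1 * z + M$2$2 = 0" for z
    by (metis add.inverse_inverse add_eq_0_iff diff_eq_eq add.left_neutral)
  then show "mat_ext_act (- M) P = mat_ext_act M P"
    by (auto simp: mat_ext_act_def mat_act_minus split: option.split)
qed

lemma mat_isometric_sphere_minus: "mat_isometric_sphere (- M) = mat_isometric_sphere M"
  by (simp add: mat_isometric_sphere_def)

lift_definition psl_act :: "psl2c \<Rightarrow> complex \<times> real \<Rightarrow> complex \<times> real" is mat_act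
  by (auto simp: psl_rel_def mat_act_minus)

lift_definition psl_ext_act :: "psl2c \<Rightarrow> ext_point \<Rightarrow> ext_point" is mat_ext_act
  by (auto simp: psl_rel_def mat_ext_act_minus)

lift_definition isometric_sphere :: "psl2c \<Rightarrow> (complex \<times> real) set" is mat_isometric_sphere
  by (auto simp: psl_rel_def mat_isometric_sphere_minus)

lift_definition psl_one :: psl2c is "mat 1"
  by (simp add: psl_rel_def)

text \<open>The class of a matrix; only meaningful for matrices of determinant 1.\<close>

definition psl_of :: "complex^2^2 \<Rightarrow> psl2c" where
  "psl_of M = abs_psl2c M"

subsection \<open>Ford fundamental domains\<close>

definition stab_inf :: "psl2c set \<Rightarrow> psl2c set" where
  "stab_inf G = {g \<in> G. psl_ext_act g None = None}"

text \<open>An element has nonzero lower left entry iff it does not fix infinity.\<close>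

definition isometric_spheres :: "psl2c set \<Rightarrow> (complex \<times> real) set set" where
  "isometric_spheres G = isometric_sphere ` (G - stab_inf G)"

text \<open>The points of upper half-space lying on or outside every hemisphere of the collection.\<close>

definition exterior :: "(complex \<times> real) set set \<Rightarrow> (complex \<times> real) set" where
  "exterior \<S> = H3 - (\<Union>{ball (z, 0) r |z r. r > 0 \<and> hemisphere z r \<in> \<S>})"

text \<open>Fundamental domains are closed in upper half-space. As \<^term>\<open>H3\<close> is open, interiors
  taken in \<^typ>\<open>complex \<times> real\<close> are interiors relative to \<^term>\<open>H3\<close>.\<close>

definition fundamental_domain :: "psl2c set \<Rightarrow> (complex \<times> real) set \<Rightarrow> bool" where
  "fundamental_domain G D \<longleftrightarrow>
     D \<subseteq> H3 \<and> closedin (top_of_set H3) D \<and>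
     (\<Union>g\<in>G. psl_act g ` D) = H3 \<and>
     (\<forall>g\<in>G. g \<noteq> psl_one \<longrightarrow> psl_act g ` interior D \<inter> interior D = {}) \<and>
     negligible (H3 \<inter> frontier D)"

definition ford_domain :: "psl2c set \<Rightarrow> (complex \<times> real) set \<Rightarrow> bool" where
  "ford_domain G F \<longleftrightarrow>
     (\<exists>D. fundamental_domain (stab_inf G) D \<and> F = exterior (isometric_spheres G) \<inter> D)"

subsection \<open>Hyperbolic convex hulls\<close>

text \<open>The geodesic from the ideal point 0 to the ideal point at infinity, endpoints included.\<close>

definition axis_point :: "ennreal \<Rightarrow> ext_point" where
  "axis_point s = (if s = \<infinity> then None else Some (0, enn2real s))"

text \<open>Complete geodesics are the images of this one under the isometries; \<^term>\<open>Q\<close> lies on the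
  geodesic segment (or ray, or line, if there are ideal endpoints) from \<^term>\<open>P\<close> to \<^term>\<open>R\<close>.\<close>

definition geod_between :: "ext_point \<Rightarrow> ext_point \<Rightarrow> ext_point \<Rightarrow> bool" where
  "geod_between P Q R \<longleftrightarrow>
     (\<exists>g r s t. r \<le> s \<and> s \<le> t \<and> P = psl_ext_act g (axis_point r) \<and>
        Q = psl_ext_act g (axis_point s) \<and> R = psl_ext_act g (axis_point t))"

definition geod_convex :: "ext_point set \<Rightarrow> bool" where
  "geod_convex C \<longleftrightarrow> (\<forall>P\<in>C. \<forall>R\<in>C. \<forall>Q. geod_between P Q R \<longrightarrow> Q \<in> C)"

text \<open>The part in \<^term>\<open>H3\<close> of the hyperbolic convex hull of a set of ordinary and ideal points.\<close>

definition hyp_hull :: "ext_point set \<Rightarrow> (complex \<times> real) set" where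
  "hyp_hull A = {x \<in> H3. Some x \<in> geod_convex hull A}"

subsection \<open>The ring of integers and its congruence subgroups\<close>

definition \<omega> :: complex where
  "\<omega> = (- 1 + \<i> * sqrt 11) / 2"

definition O11 :: "complex ring" where
  "O11 = \<lparr>carrier = {of_int m + of_int n * \<omega> |m n. True}, monoid.mult = (*), one = 1,
          zero = 0, add = (+)\<rparr>"

definition principal :: "nat \<Rightarrow> complex set" where
  "principal p = PIdl\<^bsub>O11\<^esub> (of_nat p)"

definition inert :: "nat \<Rightarrow> bool" where
  "inert p \<longleftrightarrow> primeideal (principal p) O11"

definition SL2_O11 :: "(complex^2^2) set" where
  "SL2_O11 = {M. det M = 1 \<and> (\<forall>i j. M$i$j \<in> carrier O11)}"

definition PGamma0 :: "nat \<Rightarrow> psl2c set" where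
  "PGamma0 p = psl_of ` {M \<in> SL2_O11. M$2$1 \<in> principal p}"

text \<open>The first collection is already invariant under the stabilizer of infinity, which contains
  the identity.\<close>

definition sphere_collection :: "nat \<Rightarrow> (complex \<times> real) set set" where
  "sphere_collection p =
     {hemisphere (\<alpha> / of_nat p) (1 / real p) |\<alpha>. \<alpha> \<in> carrier O11 - principal p} \<union>
     {psl_act g ` isometric_sphere (psl_of N) |g N. g \<in> stab_inf (PGamma0 p) \<and>
        (\<exists>M \<in> {mat2 1 0 (of_nat p * \<omega>) 1, mat2 1 0 (of_nat p * (\<omega> + 1)) 1}.
           N = M \<or> N = matrix_inv M)}"

lemma isometric_sphere_lower:
  assumes "c \<noteq> 0"
  shows "isometric_sphere (psl_of (mat2 1 0 c 1)) = hemisphere (- 1 / c) (1 / cmod c)"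
proof -
  have "psl_rel (mat2 1 0 c 1) (mat2 1 0 c 1)"
    by (simp add: psl_rel_def mat2_def det_2)
  then show ?thesis
    by (simp add: psl_of_def isometric_sphere.abs_eq mat_isometric_sphere_def mat2_def)
qed

lemma cmod_omega: "cmod \<omega> = sqrt 3" "cmod (\<omega> + 1) = sqrt 3"
proof -
  have "Re \<omega> = - 1 / 2" "(Im \<omega>)\<^sup>2 = 11 / 4"
    by (simp_all add: \<omega>_def power_divide)
  then show "cmod \<omega> = sqrt 3" "cmod (\<omega> + 1) = sqrt 3"
    by (simp_all add: cmod_def power_divide)
qed

definition z1 :: complex where "z1 = 3 / 11 + 6 * \<omega> / 11"
definition z2 :: complex where "z2 = - 3 / 11 + 5 * \<omega> / 11"
definition z3 :: complex where "z3 = 8 / 11 + 5 * \<omega> / 11"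

lemma z_alt: "z1 = 3 * \<i> / sqrt 11" "z2 = - 1 / 2 + 5 * \<i> / (2 * sqrt 11)"
  "z3 = 1 / 2 + 5 * \<i> / (2 * sqrt 11)"
  by (simp_all add: z1_def z2_def z3_def \<omega>_def complex_eq_iff real_div_sqrt field_simps)

text \<open>The six points above the translates by \<^term>\<open>j + k * \<omega>\<close>, before division by
  \<^term>\<open>p\<close>, of the \<^term>\<open>z\<close> and their negatives.\<close>

definition hexagon_points :: "nat \<Rightarrow> int \<Rightarrow> int \<Rightarrow> ext_point set" where
  "hexagon_points p j k =
     {Some ((s * z + of_int j + of_int k * \<omega>) / of_nat p, sqrt (2 / (11 * (real p)\<^sup>2))) |s z.
        s \<in> {1, - 1} \<and> z \<in> {z1, z2, z3}}"

end

theory Submission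
  imports Defs
begin

text \<open>After scaling by \<open>p\<close>, the isometric spheres are \<open>\<bar>\<gamma> z + d\<bar>\<^sup>2 + \<bar>\<gamma>\<bar>\<^sup>2 t\<^sup>2 = 1\<close> with \<open>d\<close> prime to
  \<open>p \<gamma>\<close>. Over the Voronoi cell (a hexagon) of a lattice point outside \<open>\<langle>p\<rangle>\<close>, the unit sphere around that
  point lies above all of them; over the cell of a point of \<open>\<langle>p\<rangle>\<close> six spheres through this cusp do, since
  the inversion in the cusp maps the region outside them to the cylinder over the hexagon. Both facts
  follow from one inequality that is symmetric in \<open>\<gamma>\<close> and \<open>d\<close>: for \<open>z\<close> in the hexagon around \<open>0\<close> and
  \<open>\<gamma> \<noteq> 0\<close>, \<open>\<bar>\<gamma>\<bar>\<^sup>2 + \<bar>d\<bar>\<^sup>2 - 1 + 2 Re (\<gamma> z d\<^sup>*) \<ge> 0\<close>, where \<open>d\<^sup>*\<close> is the conjugate of \<open>d\<close>.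
  The polyhedra over the hexagons are the convex hulls of their vertices because half-spaces are
  convex and vertical projection maps geodesics in a hemisphere to straight segments.\<close>

section \<open>The ring of integers and the hexagonal tiling\<close>

text \<open>The prime matters only through the set of lattice points at which there is a cusp.
  Inertness makes the quotient by \<open>principal p\<close> a field, so every \<alpha> outside it
  is invertible modulo p and, after scaling, the unit sphere around \<alpha> is isometric. A point
  of \<open>principal p\<close> has no such sphere, and the region reaches down to the cusp there.
  The walls of the hexagon are the bisectors
  \<open>2 * Re (cnj \<beta> * w) = - (cmod \<beta>)\<^sup>2\<close> belonging to the six shortest
  lattice vectors \<beta>, namely 1, \<omega>, \<omega> + 1 and their negatives. With s = |w|^2 +
  t^2, inversion in the unit sphere sends w to w / s and the walls to
  \<open>(cmod \<beta>)\<^sup>2 * s + 2 * Re (cnj \<beta> * w) = 0\<close>, spheres of radius 1 /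
  |\<beta>| through the cusp. For \<beta> of norm 3 this is the origin of the radius 1 / (p sqrt 3);
  for \<beta> = 1 and -1 the spheres are already among the unit spheres. The six vertices of the
  hexagon share the squared distance 9/11 from the centre, so the unit sphere has squared height
  2/11 above all of them.\<close>

lemma O11_iff: "x \<in> carrier O11 \<longleftrightarrow> (\<exists>m n. x = of_int m + of_int n * \<omega>)"
  by (simp add: O11_def)

lemma Re_Im_O11:
  "Re (of_int m + of_int n * \<omega>) = of_int m - of_int n / 2"
  "Im (of_int m + of_int n * \<omega>) = of_int n * sqrt 11 / 2"
  by (simp_all add: \<omega>_def)

lemma O11_eq_iff: "of_int m + of_int n * \<omega> = of_int j + of_int k * \<omega> \<longleftrightarrow> m = j \<and> n = k"
  unfolding complex_eq_iff Re_Im_O11 by auto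

lemma omega_sq: "\<omega> * \<omega> = - 3 - \<omega>"
  by (simp add: \<omega>_def complex_eq_iff field_simps)

lemma cnj_omega: "cnj \<omega> = - 1 - \<omega>"
  by (simp add: \<omega>_def complex_eq_iff)

lemma O11_int: "of_int m \<in> carrier O11"
  unfolding O11_iff by (rule exI[of _ m], rule exI[of _ 0]) simp

lemma O11_add: "x \<in> carrier O11 \<Longrightarrow> y \<in> carrier O11 \<Longrightarrow> x + y \<in> carrier O11"
  unfolding O11_iff
proof clarify
  fix m n j k :: int
  show "\<exists>ma na. of_int m + of_int n * \<omega> + (of_int j + of_int k * \<omega>) = of_int ma + of_int na * \<omega>"
    by (rule exI[of _ "m + j"], rule exI[of _ "n + k"]) (simp add: algebra_simps)
qed

lemma O11_mult: "x \<in> carrier O11 \<Longrightarrow> y \<in> carrier O11 \<Longrightarrow> x * y \<in> carrier O11"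
  unfolding O11_iff
proof clarify
  fix m n j k :: int
  have "(of_int m + of_int n * \<omega>) * (of_int j + of_int k * \<omega>) =
      of_int m * of_int j + (of_int m * of_int k + of_int n * of_int j) * \<omega> +
      of_int n * of_int k * (\<omega> * \<omega>)"
    by (simp add: algebra_simps)
  also have "\<dots> = of_int (m * j - 3 * n * k) + of_int (m * k + n * j - n * k) * \<omega>"
    unfolding omega_sq by (simp add: algebra_simps)
  finally show "\<exists>ma na. (of_int m + of_int n * \<omega>) * (of_int j + of_int k * \<omega>) =
      of_int ma + of_int na * \<omega>"
    by blast
qed

lemma O11_uminus: "x \<in> carrier O11 \<Longrightarrow> - x \<in> carrier O11"
  using O11_mult[OF O11_int[of "-1"], of x] by simp

lemma O11_diff: "x \<in> carrier O11 \<Longrightarrow> y \<in> carrier O11 \<Longrightarrow> x - y \<in> carrier O11"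
  using O11_add[OF _ O11_uminus, of x y] by simp

lemma O11_cnj: "x \<in> carrier O11 \<Longrightarrow> cnj x \<in> carrier O11"
  unfolding O11_iff
proof clarify
  fix m n :: int
  show "\<exists>ma na. cnj (of_int m + of_int n * \<omega>) = of_int ma + of_int na * \<omega>"
    by (rule exI[of _ "m - n"], rule exI[of _ "- n"]) (simp add: cnj_omega algebra_simps)
qed

lemma O11_omega: "\<omega> \<in> carrier O11"
  unfolding O11_iff by (rule exI[of _ 0], rule exI[of _ 1]) simp

lemmas O11_closed = O11_int O11_int[of 0, simplified] O11_int[of 1, simplified]
  O11_int[of "int _", simplified] O11_add O11_mult O11_uminus O11_diff O11_cnj O11_omega

section \<open>The norm form of discriminant -11\<close>

definition qnorm :: "int \<Rightarrow> int \<Rightarrow> int" where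
  "qnorm m n = m * m - m * n + 3 * (n * n)"

lemma cmod_O11: "(cmod (of_int m + of_int n * \<omega>))\<^sup>2 = of_int (qnorm m n)"
  unfolding cmod_power2 Re_Im_O11 qnorm_def
  by (simp add: power2_eq_square algebra_simps)

text \<open>Completing the square in either variable; the factor 11 is minus the discriminant. These
  bounds make the elements of small norm finite in number.\<close>

lemma qnorm_bounds:
  "12 * qnorm m n \<ge> 11 * (m * m)" "4 * qnorm m n \<ge> 11 * (n * n)"
proof -
  have "12 * qnorm m n = 11 * (m * m) + (m - 6 * n) * (m - 6 * n)"
    by (simp add: qnorm_def algebra_simps)
  then show "12 * qnorm m n \<ge> 11 * (m * m)"
    by (metis le_add_same_cancel1 zero_le_square)
  have "4 * qnorm m n = 11 * (n * n) + (2 * m - n) * (2 * m - n)"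
    by (simp add: qnorm_def algebra_simps)
  then show "4 * qnorm m n \<ge> 11 * (n * n)"
    by (metis le_add_same_cancel1 zero_le_square)
qed

lemma sq_lt_imp: "x * x < k * k \<Longrightarrow> 0 < k \<Longrightarrow> - k < x \<and> x < k" for x k :: int
  by (metis abs_less_iff abs_mult_self_eq abs_of_pos mult_le_less_imp_less minus_less_iff
      abs_square_less_1 linorder_not_le mult_mono' abs_ge_zero)

lemma qnorm_le_5:
  assumes "qnorm m n \<le> 5"
  shows "m \<in> {-2, -1, 0, 1, 2}" "n \<in> {-1, 0, 1}"
proof -
  have "m * m < 3 * 3" "n * n < 2 * 2"
    using qnorm_bounds(1)[where m=m and n=n] qnorm_bounds(2)[where m=m and n=n] assms by linarith+
  from sq_lt_imp[OF this(1)] sq_lt_imp[OF this(2)]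
  show "m \<in> {-2, -1, 0, 1, 2}" "n \<in> {-1, 0, 1}" by auto
qed

lemma qnorm_nonneg: "qnorm m n \<ge> 0"
  using qnorm_bounds(1)[where m=m and n=n] zero_le_square[of m] by linarith

lemma qnorm_eq_0: "qnorm m n = 0 \<longleftrightarrow> m = 0 \<and> n = 0"
proof
  assume "qnorm m n = 0"
  then have "m * m \<le> 0" "n * n \<le> 0"
    using qnorm_bounds(1)[where m=m and n=n] qnorm_bounds(2)[where m=m and n=n] by linarith+
  then show "m = 0 \<and> n = 0"
    by (smt (verit) mult_eq_0_iff zero_le_square)
qed (simp add: qnorm_def)

lemma O11_cmod_ge_1:
  assumes "x \<in> carrier O11" "x \<noteq> 0"
  shows "1 \<le> (cmod x)\<^sup>2"
proof -
  obtain m n where x: "x = of_int m + of_int n * \<omega>" using assms by (auto simp: O11_iff)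
  then have "qnorm m n \<noteq> 0" using assms by (auto simp: qnorm_eq_0)
  then have "qnorm m n \<ge> 1" using qnorm_nonneg[of m n] by linarith
  then show ?thesis unfolding x cmod_O11 by simp
qed

text \<open>For \<open>s = 1\<close> this is the Voronoi cell of the origin for the lattice of integers.\<close>

definition hex :: "real \<Rightarrow> complex set" where
  "hex s = {z. 2 * \<bar>Re z\<bar> \<le> s \<and> \<bar>Re z\<bar> + sqrt 11 * \<bar>Im z\<bar> \<le> 3 * s}"

text \<open>Homogeneity of the two defining inequalities. With s = |w|^2 + t^2, the point w / s is
  the horizontal part of the inversion of (w, t) in the unit sphere, so \<open>w \<in> hex s\<close>
  says that the inverted point lies over the Voronoi cell.\<close>

lemma hex_divide:
  assumes "s > 0"
  shows "z / of_real s \<in> hex 1 \<longleftrightarrow> z \<in> hex s"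
proof -
  have "Re (z / of_real s) = Re z / s" "Im (z / of_real s) = Im z / s" by simp_all
  moreover have "2 * \<bar>Re z / s\<bar> = 2 * \<bar>Re z\<bar> / s"
    "\<bar>Re z / s\<bar> + sqrt 11 * \<bar>Im z / s\<bar> = (\<bar>Re z\<bar> + sqrt 11 * \<bar>Im z\<bar>) / s"
    using assms by (simp_all add: abs_divide add_divide_distrib)
  ultimately show ?thesis
    using assms unfolding hex_def mem_Collect_eq by (simp add: divide_le_eq)
qed

text \<open>9/11 is the squared circumradius. The deficit \<open>x * (1 - 2 * x)\<close> vanishes at
  0 and 1/2, the values of |Re| at the vertices.\<close>

lemma hex_cmod:
  assumes "z \<in> hex 1"
  shows "(cmod z)\<^sup>2 \<le> 9 / 11"
proof -
  define x y where "x = \<bar>Re z\<bar>" and "y = sqrt 11 * \<bar>Im z\<bar>"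
  have h: "0 \<le> x" "2 * x \<le> 1" "x + y \<le> 3" "0 \<le> y"
    using assms by (auto simp: hex_def x_def y_def)
  have "11 * (cmod z)\<^sup>2 = 11 * x\<^sup>2 + y\<^sup>2"
    by (simp add: cmod_power2 x_def y_def power_mult_distrib)
  also have "y\<^sup>2 \<le> (3 - x)\<^sup>2" using h by (intro power_mono) auto
  also have "11 * x\<^sup>2 + (3 - x)\<^sup>2 = 9 - 6 * (x * (1 - 2 * x))"
    by (simp add: power2_eq_square algebra_simps)
  also have "\<dots> \<le> 9" using h by simp
  finally show ?thesis by simp
qed

text \<open>A linear form on a polygon is largest at a vertex. In the coordinates X = Re z, Y =
  \<open>sqrt 11\<close> Im z the vertices are, up to signs, (0, 3) and (1/2, 5/2); they give the
  two conditions on K.\<close>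

lemma hex_linear:
  assumes "2 * \<bar>X\<bar> \<le> 1" "\<bar>X\<bar> + \<bar>Y\<bar> \<le> 3" "3 * \<bar>q\<bar> \<le> K" "\<bar>p\<bar> + 5 * \<bar>q\<bar> \<le> 2 * K"
  shows "\<bar>p * X - q * Y\<bar> \<le> (K :: real)"
proof -
  have "\<bar>p * X - q * Y\<bar> \<le> \<bar>p\<bar> * \<bar>X\<bar> + \<bar>q\<bar> * \<bar>Y\<bar>"
    by (metis abs_mult abs_triangle_ineq4)
  also have "\<dots> \<le> \<bar>p\<bar> * \<bar>X\<bar> + \<bar>q\<bar> * (3 - \<bar>X\<bar>)"
    using assms by (intro add_left_mono mult_left_mono) auto
  also have "\<dots> = 3 * \<bar>q\<bar> + \<bar>X\<bar> * (\<bar>p\<bar> - \<bar>q\<bar>)" by (simp add: algebra_simps)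
  also have "\<dots> \<le> K"
  proof (cases "\<bar>p\<bar> \<le> \<bar>q\<bar>")
    case True
    then have "\<bar>X\<bar> * (\<bar>p\<bar> - \<bar>q\<bar>) \<le> 0" by (simp add: mult_nonneg_nonpos)
    with assms(3) show ?thesis by simp
  next
    case False
    then have "\<bar>X\<bar> * (\<bar>p\<bar> - \<bar>q\<bar>) \<le> 1 / 2 * (\<bar>p\<bar> - \<bar>q\<bar>)"
      using assms by (intro mult_right_mono) auto
    moreover have "3 * \<bar>q\<bar> + 1 / 2 * (\<bar>p\<bar> - \<bar>q\<bar>) \<le> K" using assms(4) by (simp add: field_simps)
    ultimately show ?thesis by linarith
  qed
  finally show ?thesis .
qed

text \<open>The two vertex conditions of \<open>hex_linear\<close> for K = |\<gamma>|^2 + |d|^2 - 1.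
  The box contains all pairs of norms at most 5. A vanishing \<gamma> has to be excluded, since
  \<gamma> = d = 0 would give K = -1.\<close>

lemma small_norm_check:
  "\<forall>a\<in>{-2,-1,0,1,2::int}. \<forall>b\<in>{-1,0,1}. \<forall>c\<in>{-2,-1,0,1,2}. \<forall>e\<in>{-1,0,1}.
     1 \<le> qnorm a b \<longrightarrow>
     3 * \<bar>b * c - a * e\<bar> \<le> qnorm a b + qnorm c e - 1 \<and>
     \<bar>2 * (a * c) - (a * e + b * c) + 6 * (b * e)\<bar> + 5 * \<bar>b * c - a * e\<bar>
       \<le> 2 * (qnorm a b + qnorm c e - 1)"
  unfolding qnorm_def by simp

text \<open>Absorbing \<open>sqrt 11\<close> into the imaginary part leaves integer coefficients, so
  that the vertex conditions become statements about integers.\<close>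

lemma Re_mult_cnj_O11:
  "2 * Re ((of_int a + of_int b * \<omega>) * z * cnj (of_int c + of_int e * \<omega>)) =
     of_int (2 * (a * c) - (a * e + b * c) + 6 * (b * e)) * Re z
     - of_int (b * c - a * e) * (sqrt 11 * Im z)"
  by (simp add: \<omega>_def field_simps)

text \<open>If \<open>\<gamma>\<close> or \<open>d\<close> has norm at least 6, completing the square suffices since \<open>\<bar>z\<bar>\<^sup>2 \<le> 9/11\<close>;
  the remaining pairs are finitely many, and for them the expression is affine in \<open>z\<close>.\<close>

lemma hex_reduced:
  assumes z: "z \<in> hex 1" and g: "\<gamma> \<in> carrier O11" "\<gamma> \<noteq> 0" and d: "d \<in> carrier O11"
  shows "(cmod \<gamma>)\<^sup>2 + (cmod d)\<^sup>2 - 1 + 2 * Re (\<gamma> * z * cnj d) \<ge> 0"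
proof -
  obtain a b where ab: "\<gamma> = of_int a + of_int b * \<omega>" using g by (auto simp: O11_iff)
  obtain c e where ce: "d = of_int c + of_int e * \<omega>" using d by (auto simp: O11_iff)
  have sq: "(cmod (u + v))\<^sup>2 = (cmod u)\<^sup>2 + (cmod v)\<^sup>2 + 2 * Re (u * cnj v)" for u v
    unfolding cmod_power2 by (simp add: power2_eq_square algebra_simps)
  \<comment> \<open>N - 1 - 9 N / 11 is nonnegative exactly from N = 11/2 on, and norms are
    integers: hence the threshold 6.\<close>
  have large: "0 \<le> (cmod u)\<^sup>2 - 1 - (cmod (u * z))\<^sup>2" if "(cmod u)\<^sup>2 \<ge> 6" for u
  proof -
    have "(cmod (u * z))\<^sup>2 \<le> (cmod u)\<^sup>2 * (9 / 11)"
      unfolding norm_mult power_mult_distrib by (intro mult_left_mono hex_cmod z) simp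
    then show ?thesis using that by simp
  qed
  consider "(cmod \<gamma>)\<^sup>2 \<ge> 6" | "(cmod d)\<^sup>2 \<ge> 6" | "(cmod \<gamma>)\<^sup>2 < 6" "(cmod d)\<^sup>2 < 6"
    by linarith
  then show ?thesis
  proof cases
    case 1
    have "0 \<le> (cmod (\<gamma> * z + d))\<^sup>2" by simp
    then show ?thesis using large[OF 1] sq[of "\<gamma> * z" d] by linarith
  next
    case 2
    \<comment> \<open>Here \<gamma> and d exchange roles: the same cross term arises from the square
      of \<gamma> + d \<open>cnj z\<close>, and conjugating z does not change the absolute
      value.\<close>
    have "(cmod (d * cnj z))\<^sup>2 = (cmod (d * z))\<^sup>2" by (simp add: norm_mult)
    moreover have "Re (\<gamma> * cnj (d * cnj z)) = Re (\<gamma> * z * cnj d)"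
      by (simp add: algebra_simps)
    moreover have "0 \<le> (cmod (\<gamma> + d * cnj z))\<^sup>2" by simp
    ultimately show ?thesis using large[OF 2] sq[of "\<gamma>" "d * cnj z"] by linarith
  next
    case 3
    have n: "qnorm a b \<le> 5" "qnorm c e \<le> 5" using 3 unfolding ab ce cmod_O11 by linarith+
    have "qnorm a b \<noteq> 0" using g ab by (auto simp: qnorm_eq_0)
    then have "1 \<le> qnorm a b" using qnorm_nonneg[of a b] by linarith
    with small_norm_check qnorm_le_5[OF n(1)] qnorm_le_5[OF n(2)]
    have i: "3 * \<bar>b * c - a * e\<bar> \<le> qnorm a b + qnorm c e - 1"
      "\<bar>2 * (a * c) - (a * e + b * c) + 6 * (b * e)\<bar> + 5 * \<bar>b * c - a * e\<bar>
       \<le> 2 * (qnorm a b + qnorm c e - 1)"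
      by blast+
    have "\<bar>of_int (2 * (a * c) - (a * e + b * c) + 6 * (b * e)) * Re z
        - of_int (b * c - a * e) * (sqrt 11 * Im z)\<bar> \<le> real_of_int (qnorm a b + qnorm c e - 1)"
    proof (rule hex_linear)
      show "2 * \<bar>Re z\<bar> \<le> 1" "\<bar>Re z\<bar> + \<bar>sqrt 11 * Im z\<bar> \<le> 3"
        using z by (auto simp: hex_def abs_mult)
    qed (use i in linarith)+
    then show ?thesis
      unfolding ab ce cmod_O11 Re_mult_cnj_O11 by linarith
  qed
qed

text \<open>Rounding to the nearest row of the lattice and then within the row brings w into the
  rectangle |Re| \<le> 1/2, |Im| \<le> \<open>sqrt 11 / 4\<close>. The corners that stick out of the
  hexagon around 0 lie in the hexagons around \<omega>, \<omega> + 1 and their negatives.\<close>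

lemma hex_tiling: "\<exists>l\<in>carrier O11. w - l \<in> hex 1"
proof -
  have reduce: "\<exists>l\<in>carrier O11. v - l \<in> hex 1"
    if v: "2 * \<bar>Re v\<bar> \<le> 1" "4 * (sqrt 11 * \<bar>Im v\<bar>) \<le> 11" for v
  proof (cases "v \<in> hex 1")
    case True
    then show ?thesis by (intro bexI[of _ 0]) (auto intro: O11_closed)
  next
    case False
    \<comment> \<open>The signs of the quadrant of v. The lattice point with real part e / 2 and
      imaginary part f \<open>sqrt 11 / 2\<close> is the neighbour in that quadrant; it is integral
      because e + f is even.\<close>
    define e f :: int where "e = (if Re v \<ge> 0 then 1 else -1)" and "f = (if Im v \<ge> 0 then 1 else -1)"
    have par: "\<exists>k. e + f = 2 * k" by (auto simp: e_def f_def intro: exI[of _ 1] exI[of _ 0] exI[of _ "-1"])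
    then obtain k where k: "e + f = 2 * k" by blast
    define l where "l = of_int k + of_int f * \<omega>"
    have "e = 2 * k - f" using k by simp
    then have ek: "real_of_int e = 2 * of_int k - of_int f" by simp
    have lRI: "Re l = of_int e / 2" "sqrt 11 * Im l = 11 * of_int f / 2"
      unfolding l_def Re_Im_O11 by (simp_all add: ek)
    have "\<bar>Re v\<bar> + sqrt 11 * \<bar>Im v\<bar> > 3" using False v by (auto simp: hex_def)
    moreover have "\<bar>Re (v - l)\<bar> = 1 / 2 - \<bar>Re v\<bar>"
      using v(1) lRI(1) by (auto simp: e_def split: if_splits)
    moreover have "sqrt 11 * \<bar>Im (v - l)\<bar> = 11 / 2 - sqrt 11 * \<bar>Im v\<bar>"
    proof -
      have "sqrt 11 * \<bar>Im (v - l)\<bar> = \<bar>sqrt 11 * Im v - sqrt 11 * Im l\<bar>"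
        by (simp add: abs_mult flip: right_diff_distrib)
      moreover have "sqrt 11 * \<bar>Im v\<bar> = \<bar>sqrt 11 * Im v\<bar>" by (simp add: abs_mult)
      moreover have "sqrt 11 * Im v \<ge> 0 \<longleftrightarrow> Im v \<ge> 0" by (simp add: zero_le_mult_iff)
      ultimately show ?thesis using v(2) unfolding lRI(2) f_def by auto
    qed
    ultimately have "v - l \<in> hex 1" using v unfolding hex_def by auto
    moreover have "l \<in> carrier O11" unfolding l_def O11_iff by blast
    ultimately show ?thesis by blast
  qed
  define n where "n = round (2 * Im w / sqrt 11)"
  define m where "m = round (Re w + of_int n / 2)"
  define l where "l = of_int m + of_int n * \<omega>"
  have "2 * \<bar>Re (w - l)\<bar> \<le> 1"
    using of_int_round_abs_le[of "Re w + of_int n / 2"]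
    unfolding l_def Re_Im_O11 minus_complex.sel m_def[symmetric] by (simp add: abs_if split: if_splits)
  moreover have "4 * (sqrt 11 * \<bar>Im (w - l)\<bar>) \<le> 11"
  proof -
    have "Im (w - l) = sqrt 11 / 2 * (2 * Im w / sqrt 11 - of_int n)"
      unfolding l_def Re_Im_O11 minus_complex.sel by (simp add: field_simps)
    then have "4 * (sqrt 11 * \<bar>Im (w - l)\<bar>) =
        2 * (sqrt 11 * sqrt 11) * \<bar>2 * Im w / sqrt 11 - of_int n\<bar>"
      by (simp only: abs_mult) (simp add: mult.assoc)
    then have "4 * (sqrt 11 * \<bar>Im (w - l)\<bar>) = 22 * \<bar>2 * Im w / sqrt 11 - of_int n\<bar>"
      by simp
    also have "\<dots> \<le> 22 * (1 / 2)"
      using of_int_round_abs_le[of "2 * Im w / sqrt 11"]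
      unfolding n_def[symmetric] abs_minus_commute[of "of_int n"] by (intro mult_left_mono) simp_all
    finally show ?thesis by simp
  qed
  ultimately obtain l' where "l' \<in> carrier O11" "w - l - l' \<in> hex 1" using reduce by blast
  moreover have "l \<in> carrier O11" unfolding l_def O11_iff by blast
  ultimately show ?thesis
    by (metis O11_add diff_diff_eq)
qed

section \<open>Matrices and geodesics\<close>

lemma mat2_simps [simp]:
  "mat2 a b c d $ 1 $ 1 = a" "mat2 a b c d $ 1 $ 2 = b"
  "mat2 a b c d $ 2 $ 1 = c" "mat2 a b c d $ 2 $ 2 = d"
  by (simp_all add: mat2_def)

lemma det_mat2 [simp]: "det (mat2 a b c d) = a * d - b * c"
  by (simp add: det_2)

lemma psl_of_lift:
  assumes "det M = 1"
  shows "psl_act (psl_of M) = mat_act M" "psl_ext_act (psl_of M) = mat_ext_act M"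
    "isometric_sphere (psl_of M) = mat_isometric_sphere M"
  using assms
  by (simp_all add: psl_of_def psl_act.abs_eq psl_ext_act.abs_eq isometric_sphere.abs_eq psl_rel_def)

lemma psl_of_cases: obtains M where "det M = 1" "g = psl_of M"
  by (induction g rule: psl2c.abs_induct) (auto simp: psl_rel_def psl_of_def)

lemma psl_of_eq_one_iff:
  assumes "det M = 1"
  shows "psl_of M = psl_one \<longleftrightarrow> M = mat 1 \<or> M = - mat 1"
proof -
  have "psl_rel M M" "psl_rel (mat 1) (mat 1)" using assms by (simp_all add: psl_rel_def)
  then have "abs_psl2c M = abs_psl2c (mat 1) \<longleftrightarrow> psl_rel M (mat 1)"
    by (metis Quotient3_psl2c Quotient3_rel)
  also have "\<dots> \<longleftrightarrow> M = mat 1 \<or> M = - mat 1"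
    using assms by (auto simp: psl_rel_def)
  finally show ?thesis by (simp add: psl_of_def psl_one_def)
qed

lemma mat2_eqI:
  "M$1$1 = N$1$1 \<Longrightarrow> M$1$2 = N$1$2 \<Longrightarrow> M$2$1 = N$2$1 \<Longrightarrow> M$2$2 = N$2$2 \<Longrightarrow> M = N"
  for M N :: "complex^2^2"
  by (simp add: vec_eq_iff forall_2)

text \<open>\<open>matrix_inv\<close> is defined by a choice, so its value is pinned down by
  uniqueness of inverses.\<close>

lemma matrix_inv_lower: "matrix_inv (mat2 1 0 c 1) = mat2 1 0 (- c) 1"
proof -
  have *: "mat2 1 0 c 1 ** mat2 1 0 (- c) 1 = mat 1" "mat2 1 0 (- c) 1 ** mat2 1 0 c 1 = mat 1" for c
    by (rule mat2_eqI; simp add: matrix_matrix_mult_def sum_2 mat_def)+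
  then have "invertible (mat2 1 0 c 1)" unfolding invertible_def by blast
  then have "matrix_inv (mat2 1 0 c 1) ** mat2 1 0 c 1 = mat 1"
    unfolding invertible_def matrix_inv_def by (rule someI2_ex) blast
  then have "matrix_inv (mat2 1 0 c 1) ** (mat2 1 0 c 1 ** mat2 1 0 (- c) 1) = mat2 1 0 (- c) 1"
    by (simp add: matrix_mul_assoc)
  then show ?thesis by (simp add: *)
qed

section \<open>Geodesic segments in coordinates\<close>

lemma axis_point_ennreal: "0 \<le> s \<Longrightarrow> axis_point (ennreal s) = Some (0, s)"
  by (simp add: axis_point_def)

lemma geod_betweenI:
  assumes "det M = 1" "0 \<le> r" "r \<le> s" "s \<le> t"
    "mat_ext_act M (Some (0, r)) = P" "mat_ext_act M (Some (0, s)) = Q"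
    "mat_ext_act M (Some (0, t)) = R"
  shows "geod_between P Q R"
  unfolding geod_between_def
  by (rule exI[of _ "psl_of M"], rule exI[of _ "ennreal r"], rule exI[of _ "ennreal s"],
      rule exI[of _ "ennreal t"])
    (use assms in \<open>auto simp: psl_of_lift axis_point_ennreal intro: ennreal_leI\<close>)

lemma mat_ext_act_translation: "mat_ext_act (mat2 1 z 0 1) (Some (0, s)) = Some (z, s)"
  by (simp add: mat_ext_act_def mat_act_def)

lemma geod_vertical:
  assumes "0 \<le> r" "r \<le> s" "s \<le> t"
  shows "geod_between (Some (z, r)) (Some (z, s)) (Some (z, t))"
  by (rule geod_betweenI[of "mat2 1 z 0 1"]) (use assms in \<open>simp_all add: mat_ext_act_translation\<close>)

lemma geod_vertical_infinity:
  assumes "0 \<le> r" "r \<le> s"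
  shows "geod_between (Some (z, r)) (Some (z, s)) None"
  unfolding geod_between_def
proof (intro exI conjI)
  show "ennreal r \<le> ennreal s" "ennreal s \<le> \<infinity>" using assms by (auto intro: ennreal_leI)
  have "det (mat2 1 z 0 1) = 1" by simp
  note * = psl_of_lift(2)[OF this]
  show "Some (z, r) = psl_ext_act (psl_of (mat2 1 z 0 1)) (axis_point (ennreal r))"
    "Some (z, s) = psl_ext_act (psl_of (mat2 1 z 0 1)) (axis_point (ennreal s))"
    using assms by (simp_all add: * axis_point_ennreal mat_ext_act_translation)
  show "None = psl_ext_act (psl_of (mat2 1 z 0 1)) (axis_point \<infinity>)"
    unfolding * by (simp add: axis_point_def mat_ext_act_def)
qed

text \<open>The geodesic with ideal endpoints \<open>u\<close> and \<open>v\<close>, parametrized by its vertical projection to the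
  segment from \<open>u\<close> to \<open>v\<close>.\<close>

definition semicircle :: "complex \<Rightarrow> complex \<Rightarrow> real \<Rightarrow> ext_point" where
  "semicircle u v \<theta> = Some (u + of_real \<theta> * (v - u), cmod (v - u) * sqrt (\<theta> * (1 - \<theta>)))"

text \<open>The matrix with columns (v, 1) and (u, 1) sends infinity to v and 0 to u; dividing by a
  square root e of its determinant v - u normalizes it. Height s on the axis goes to \<theta> = s^2
  / (1 + s^2), so s = \<open>sqrt (\<theta> / (1 - \<theta>))\<close>. The bound \<theta>3 < 1 keeps
  away from v, the image of infinity.\<close>

lemma geod_arc:
  assumes "u \<noteq> v" "0 \<le> \<theta>1" "\<theta>1 \<le> \<theta>2" "\<theta>2 \<le> \<theta>3" "\<theta>3 < 1"
  shows "geod_between (semicircle u v \<theta>1) (semicircle u v \<theta>2) (semicircle u v \<theta>3)"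
proof -
  define e where "e = csqrt (v - u)"
  have e: "e * e = v - u" "e \<noteq> 0"
    using assms(1) unfolding e_def by (simp_all flip: power2_eq_square)
  define M where "M = mat2 (v / e) (u / e) (1 / e) (1 / e)"
  have "v / e * (1 / e) - u / e * (1 / e) = (v - u) / (e * e)"
    by (simp add: diff_divide_distrib)
  then have det: "det M = 1" using e assms(1) by (simp add: M_def)
  have cm: "cmod e * cmod e = cmod (v - u)" by (simp flip: e norm_mult)
  have e0: "cmod e > 0" using e by simp
  have act: "mat_ext_act M (Some (0, sqrt (\<theta> / (1 - \<theta>)))) = semicircle u v \<theta>" if "0 \<le> \<theta>" "\<theta> < 1" for \<theta>
  proof -
    define s where "s = sqrt (\<theta> / (1 - \<theta>))"
    have s2: "s\<^sup>2 = \<theta> / (1 - \<theta>)" unfolding s_def using that by simp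
    have n: "(cmod (1 / e * 0 + 1 / e))\<^sup>2 + (cmod (1 / e))\<^sup>2 * s\<^sup>2 = 1 / ((cmod e)\<^sup>2 * (1 - \<theta>))"
      unfolding s2 using that e0 by (simp add: norm_divide power_divide field_simps)
    have "e * cnj e = of_real ((cmod e)\<^sup>2)" by (rule complex_norm_square[symmetric])
    have "((v / e * 0 + u / e) * cnj (1 / e * 0 + 1 / e) + v / e * cnj (1 / e) * of_real (s\<^sup>2)) /
        of_real (1 / ((cmod e)\<^sup>2 * (1 - \<theta>))) =
        (u + v * of_real (s\<^sup>2)) / (e * cnj e) * (of_real ((cmod e)\<^sup>2) * of_real (1 - \<theta>))"
      using e by (simp add: field_simps)
    also have "\<dots> = (u + v * of_real (s\<^sup>2)) * of_real (1 - \<theta>)"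
      unfolding \<open>e * cnj e = _\<close> using e0 by simp
    also have "\<dots> = u * of_real (1 - \<theta>) + v * of_real (s\<^sup>2 * (1 - \<theta>))"
      by (simp add: algebra_simps)
    also have "s\<^sup>2 * (1 - \<theta>) = \<theta>" unfolding s2 using that by simp
    finally have z: "((v / e * 0 + u / e) * cnj (1 / e * 0 + 1 / e) + v / e * cnj (1 / e) * of_real (s\<^sup>2)) /
        of_real (1 / ((cmod e)\<^sup>2 * (1 - \<theta>))) = u + of_real \<theta> * (v - u)"
      by (simp add: algebra_simps)
    have "s * (1 - \<theta>) = sqrt (\<theta> * (1 - \<theta>))"
    proof (rule real_sqrt_unique[symmetric])
      show "(s * (1 - \<theta>))\<^sup>2 = \<theta> * (1 - \<theta>)"
        unfolding power_mult_distrib s2 using that by (simp add: power2_eq_square)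
      show "0 \<le> s * (1 - \<theta>)" unfolding s_def using that by simp
    qed
    then have t: "s / (1 / ((cmod e)\<^sup>2 * (1 - \<theta>))) = cmod (v - u) * sqrt (\<theta> * (1 - \<theta>))"
      by (simp add: cm power2_eq_square mult.assoc mult.left_commute flip: cm)
    have "1 / e \<noteq> 0" using e by simp
    then show ?thesis
      unfolding mat_ext_act_def mat_act_def Let_def M_def s_def[symmetric] semicircle_def
      by (simp only: option.case prod.case mat2_simps n z t) simp
  qed
  show ?thesis
    by (rule geod_betweenI[OF det, of "sqrt (\<theta>1 / (1 - \<theta>1))" "sqrt (\<theta>2 / (1 - \<theta>2))"
          "sqrt (\<theta>3 / (1 - \<theta>3))"])
      (use assms in \<open>auto intro!: frac_le act\<close>)
qed

section \<open>Half-spaces\<close>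

text \<open>Every hyperbolic half-space together with its ideal boundary is of this form.\<close>

definition halfspace :: "real \<Rightarrow> complex \<Rightarrow> real \<Rightarrow> ext_point set" where
  "halfspace A B C = {P. case P of None \<Rightarrow> A \<ge> 0
     | Some (z, t) \<Rightarrow> A * ((cmod z)\<^sup>2 + t\<^sup>2) + 2 * Re (cnj B * z) + C \<ge> 0}"

lemma halfspace_simps [simp]:
  "None \<in> halfspace A B C \<longleftrightarrow> A \<ge> 0"
  "Some (z, t) \<in> halfspace A B C \<longleftrightarrow> A * ((cmod z)\<^sup>2 + t\<^sup>2) + 2 * Re (cnj B * z) + C \<ge> 0"
  by (simp_all add: halfspace_def)

text \<open>A Lagrange identity: for determinant 1 it exhibits |z|^2 + t^2 of the image point as a
  quotient with the single denominator n instead of its square.\<close>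

lemma cmod_action_identity:
  "(cmod (b * cnj d + a * cnj c * of_real (s\<^sup>2)))\<^sup>2 + s\<^sup>2 * (cmod (a * d - b * c))\<^sup>2 =
     ((cmod b)\<^sup>2 + (cmod a)\<^sup>2 * s\<^sup>2) * ((cmod d)\<^sup>2 + (cmod c)\<^sup>2 * s\<^sup>2)"
  unfolding cmod_power2 by (simp add: power2_eq_square algebra_simps)

text \<open>Pulled back to the geodesic from \<open>0\<close> to \<open>\<infinity>\<close>, a half-space is given by an inequality that is
  affine in the square of the height.\<close>

lemma halfspace_axis:
  assumes "det M = 1"
  obtains U V where
    "\<And>s. s \<ge> 0 \<Longrightarrow> mat_ext_act M (Some (0, s)) \<in> halfspace A B C \<longleftrightarrow> U + V * s\<^sup>2 \<ge> 0"
    "mat_ext_act M None \<in> halfspace A B C \<longleftrightarrow> V \<ge> 0"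
proof -
  define a b c d where "a = M$1$1" and "b = M$1$2" and "c = M$2$1" and "d = M$2$2"
  note defs = this
  have det: "a * d - b * c = 1" using assms by (simp add: det_2 defs)
  \<comment> \<open>The Hermitian form with coefficients A, B, C on the two columns of the matrix: U
    belongs to the image of 0, V to the image of infinity.\<close>
  define U where "U = A * (cmod b)\<^sup>2 + 2 * Re (cnj B * (b * cnj d)) + C * (cmod d)\<^sup>2"
  define V where "V = A * (cmod a)\<^sup>2 + 2 * Re (cnj B * (a * cnj c)) + C * (cmod c)\<^sup>2"
  have "mat_ext_act M (Some (0, s)) \<in> halfspace A B C \<longleftrightarrow> U + V * s\<^sup>2 \<ge> 0" if "s \<ge> 0" for s
  proof (cases "s = 0 \<and> d = 0")
    case True
    then have "b \<noteq> 0" using det by auto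
    then have "U + V * s\<^sup>2 \<ge> 0 \<longleftrightarrow> A \<ge> 0"
      using True by (simp add: U_def zero_le_mult_iff)
    then show ?thesis using True by (simp add: mat_ext_act_def defs[symmetric])
  next
    case False
    define n where "n = (cmod d)\<^sup>2 + (cmod c)\<^sup>2 * s\<^sup>2"
    define w where "w = b * cnj d + a * cnj c * of_real (s\<^sup>2)"
    have n: "n > 0"
    proof (cases "d = 0")
      case True
      then have "c \<noteq> 0" using det by auto
      then show ?thesis using True False unfolding n_def by simp
    next
      case False
      then show ?thesis unfolding n_def by (simp add: add_pos_nonneg)
    qed
    have P: "mat_ext_act M (Some (0, s)) = Some (w / of_real n, s / n)"
      using False
      by (auto simp: mat_ext_act_def mat_act_def defs[symmetric] n_def w_def)
    have "(cmod w)\<^sup>2 + s\<^sup>2 = ((cmod b)\<^sup>2 + (cmod a)\<^sup>2 * s\<^sup>2) * n"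
      using cmod_action_identity[of b d a c s] unfolding det w_def n_def by simp
    moreover have "(cmod (w / of_real n))\<^sup>2 + (s / n)\<^sup>2 = ((cmod w)\<^sup>2 + s\<^sup>2) / n / n"
      using n by (simp add: norm_divide power_divide add_divide_distrib power2_eq_square)
    ultimately have h: "(cmod (w / of_real n))\<^sup>2 + (s / n)\<^sup>2 = ((cmod b)\<^sup>2 + (cmod a)\<^sup>2 * s\<^sup>2) / n"
      using n by simp
    have "cnj B * w = cnj B * (b * cnj d) + of_real (s\<^sup>2) * (cnj B * (a * cnj c))"
      by (simp add: w_def algebra_simps)
    then have r: "Re (cnj B * w) = Re (cnj B * (b * cnj d)) + s\<^sup>2 * Re (cnj B * (a * cnj c))"
      by (simp only: plus_complex.sel Re_complex_of_real Im_complex_of_real times_complex.sel)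
    have "Re (cnj B * (w / of_real n)) = Re (cnj B * w) / n"
      by (metis Re_divide_of_real times_divide_eq_right)
    then have "A * ((cmod (w / of_real n))\<^sup>2 + (s / n)\<^sup>2) + 2 * Re (cnj B * (w / of_real n)) + C =
        (A * ((cmod b)\<^sup>2 + (cmod a)\<^sup>2 * s\<^sup>2) + 2 * Re (cnj B * w) + C * n) / n"
      unfolding h using n by (simp add: field_simps)
    also have "\<dots> = (U + V * s\<^sup>2) / n"
      unfolding r by (simp add: n_def U_def V_def algebra_simps)
    finally show ?thesis unfolding P halfspace_simps using n by (simp add: zero_le_divide_iff)
  qed
  moreover have "mat_ext_act M None \<in> halfspace A B C \<longleftrightarrow> V \<ge> 0"
  proof (cases "c = 0")
    case True
    then have "a \<noteq> 0" using det by auto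
    then show ?thesis
      using True by (simp add: mat_ext_act_def defs[symmetric] V_def zero_le_mult_iff)
  next
    case False
    have "a / c = a * cnj c / of_real ((cmod c)\<^sup>2)"
      unfolding complex_norm_square using False by simp
    then have "Re (cnj B * (a / c)) = Re (cnj B * (a * cnj c)) / (cmod c)\<^sup>2"
      by (metis Re_divide_of_real times_divide_eq_right)
    then have "A * ((cmod (a / c))\<^sup>2 + 0\<^sup>2) + 2 * Re (cnj B * (a / c)) + C = V / (cmod c)\<^sup>2"
      using False by (simp add: V_def norm_divide power_divide field_simps)
    then show ?thesis
      using False by (simp add: mat_ext_act_def defs[symmetric] zero_le_divide_iff)
  qed
  ultimately show ?thesis using that by blast
qed

text \<open>An inequality affine in the squared height is monotone along the axis, so it passes from
  one end to the middle. For V \<ge> 0 the lower end is used, for V < 0 the upper one; the latter is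
  then finite, because infinity violates the inequality.\<close>

lemma geod_convex_halfspace: "geod_convex (halfspace A B C)"
  unfolding geod_convex_def
proof (intro ballI allI impI)
  fix P R Q
  assume P: "P \<in> halfspace A B C" and R: "R \<in> halfspace A B C" and "geod_between P Q R"
  then obtain g r s t where g: "r \<le> s" "s \<le> t" "P = psl_ext_act g (axis_point r)"
    "Q = psl_ext_act g (axis_point s)" "R = psl_ext_act g (axis_point t)"
    by (auto simp: geod_between_def)
  obtain M where M: "det M = 1" "g = psl_of M" by (rule psl_of_cases)
  obtain U V where UV:
    "\<And>s. s \<ge> 0 \<Longrightarrow> mat_ext_act M (Some (0, s)) \<in> halfspace A B C \<longleftrightarrow> U + V * s\<^sup>2 \<ge> 0"
    "mat_ext_act M None \<in> halfspace A B C \<longleftrightarrow> V \<ge> 0"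
    using halfspace_axis[OF M(1), of A B C] by blast
  have g': "P = mat_ext_act M (axis_point r)" "Q = mat_ext_act M (axis_point s)"
    "R = mat_ext_act M (axis_point t)"
    using g M psl_of_lift(2) by simp_all
  show "Q \<in> halfspace A B C"
  proof (cases s)
    case top
    then show ?thesis using g g' R by (simp add: top_unique)
  next
    case (real s')
    with g(1) obtain r' where r': "r = ennreal r'" "0 \<le> r'" "r' \<le> s'"
      by (cases r) (auto simp: top_unique)
    have sq: "r'\<^sup>2 \<le> s'\<^sup>2" using r' by (intro power_mono)
    have U: "U + V * r'\<^sup>2 \<ge> 0" using P UV(1) r' g' by (simp add: axis_point_ennreal)
    have "U + V * s'\<^sup>2 \<ge> 0"
    proof (cases "V \<ge> 0")
      case True
      then show ?thesis using U mult_left_mono[OF sq True] by linarith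
    next
      case False
      then have "t \<noteq> \<infinity>" using R UV(2) g' by (auto simp: axis_point_def)
      then obtain t' where t': "t = ennreal t'" "0 \<le> t'" by (cases t) auto
      then have "s' \<le> t'" using g(2) real by simp
      then have "s'\<^sup>2 \<le> t'\<^sup>2" using real by (intro power_mono)
      moreover have "U + V * t'\<^sup>2 \<ge> 0" using R UV(1) t' g' by (simp add: axis_point_ennreal)
      ultimately show ?thesis using False mult_left_mono_neg[of "s'\<^sup>2" "t'\<^sup>2" V] by linarith
    qed
    then show ?thesis using UV(1) real g' by (simp add: axis_point_ennreal)
  qed
qed

section \<open>Spheres and their exteriors\<close>

lemma dist_center: "dist (z, 0) (w, t) = sqrt ((cmod (w - z))\<^sup>2 + t\<^sup>2)"
  unfolding dist_Pair_Pair by (simp add: dist_norm norm_minus_commute)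

lemma mem_hemisphere:
  assumes "r > 0"
  shows "(w, t) \<in> hemisphere z r \<longleftrightarrow> t > 0 \<and> (cmod (w - z))\<^sup>2 + t\<^sup>2 = r\<^sup>2"
proof -
  have "sqrt ((cmod (w - z))\<^sup>2 + t\<^sup>2) = r \<longleftrightarrow> (cmod (w - z))\<^sup>2 + t\<^sup>2 = r\<^sup>2"
    using assms by (auto intro!: real_sqrt_unique)
  then show ?thesis
    by (auto simp: hemisphere_def H3_def dist_center)
qed

text \<open>The topmost point of each hemisphere is tested against the other.
  \<open>exterior\<close> reads centres and radii off hemispheres given as sets, so they must be
  determined by these sets.\<close>

lemma hemisphere_inject:
  assumes "r > 0" "r' > 0" "hemisphere z r = hemisphere z' r'"
  shows "z = z'" "r = r'"
proof -
  have "(z, r) \<in> hemisphere z' r'" "(z', r') \<in> hemisphere z r"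
    using assms mem_hemisphere[of r z r z] mem_hemisphere[of r' z' r' z'] by auto
  then have "(cmod (z - z'))\<^sup>2 + r\<^sup>2 = r'\<^sup>2" "(cmod (z - z'))\<^sup>2 + r'\<^sup>2 = r\<^sup>2"
    using assms(1,2) by (simp_all add: mem_hemisphere norm_minus_commute[of z'])
  then have "(cmod (z - z'))\<^sup>2 = 0" and sq: "r\<^sup>2 = r'\<^sup>2" by linarith+
  then show "z = z'" by simp
  show "r = r'" using sq assms by (simp add: power2_eq_iff_nonneg)
qed

lemma exterior_hemispheres:
  assumes "\<And>c r. (c, r) \<in> I \<Longrightarrow> r > 0"
  shows "(z, t) \<in> exterior ((\<lambda>(c, r). hemisphere c r) ` I) \<longleftrightarrow>
    t > 0 \<and> (\<forall>(c, r)\<in>I. r\<^sup>2 \<le> (cmod (z - c))\<^sup>2 + t\<^sup>2)"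
proof -
  have ball: "(z, t) \<in> ball (c, 0) r \<longleftrightarrow> (cmod (z - c))\<^sup>2 + t\<^sup>2 < r\<^sup>2" if "r > 0" for c and r :: real
  proof -
    have "(z, t) \<in> ball (c, 0) r \<longleftrightarrow> sqrt ((cmod (z - c))\<^sup>2 + t\<^sup>2) < sqrt (r\<^sup>2)"
      using that by (simp add: dist_center)
    then show ?thesis by (simp only: real_sqrt_less_iff)
  qed
  have "(z, t) \<in> \<Union>{ball (c, 0) r |c r. r > 0 \<and> hemisphere c r \<in> (\<lambda>(c, r). hemisphere c r) ` I}
      \<longleftrightarrow> (\<exists>(c, r)\<in>I. (z, t) \<in> ball (c, 0) r)" (is "?l \<longleftrightarrow> ?r")
  proof
    assume ?l
    then obtain c r c' r' where c: "r > 0" "dist (c, 0) (z, t) < r"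
      "(c', r') \<in> I" "hemisphere c r = hemisphere c' r'" by auto
    then have "c = c'" "r = r'" using hemisphere_inject assms by blast+
    then show ?r using c by auto
  next
    assume ?r
    then obtain c r where c: "(c, r) \<in> I" "(z, t) \<in> ball (c, 0) r" by auto
    then have "hemisphere c r \<in> (\<lambda>(c, r). hemisphere c r) ` I" by force
    moreover have "r > 0" using c assms by blast
    ultimately have "ball (c, 0) r \<in> {ball (c, 0) r |c r. r > 0 \<and>
        hemisphere c r \<in> (\<lambda>(c, r). hemisphere c r) ` I}"
      by (intro CollectI exI[of _ c] exI[of _ r] conjI refl)
    then show ?l using c(2) by (rule UnionI)
  qed
  then show ?thesis
    using ball assms by (force simp: exterior_def H3_def not_less)
qed

section \<open>Isometric spheres and the stabilizer of infinity\<close>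

lemma principal_iff: "x \<in> principal p \<longleftrightarrow> (\<exists>y\<in>carrier O11. x = of_nat p * y)"
  unfolding principal_def cgenideal_def by (auto simp: O11_def mult.commute)

lemma SL2_O11_mat2:
  "mat2 a b c d \<in> SL2_O11 \<longleftrightarrow> a * d - b * c = 1 \<and> {a, b, c, d} \<subseteq> carrier O11"
  unfolding SL2_O11_def by (auto simp: forall_2)

lemma SL2_O11D:
  assumes "M \<in> SL2_O11"
  shows "det M = 1" "M$1$1 * M$2$2 - M$1$2 * M$2$1 = 1" "M$i$j \<in> carrier O11"
  using assms unfolding SL2_O11_def by (auto simp: det_2)

lemma ext_act_infinity:
  assumes "det M = 1"
  shows "psl_ext_act (psl_of M) None = None \<longleftrightarrow> M$2$1 = 0"
  using assms by (simp add: psl_of_lift mat_ext_act_def)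

lemma exterior_isometric_spheres:
  "(z, t) \<in> exterior (isometric_spheres (PGamma0 p)) \<longleftrightarrow> t > 0 \<and>
     (\<forall>M\<in>SL2_O11. M$2$1 \<in> principal p \<and> M$2$1 \<noteq> 0 \<longrightarrow>
       1 \<le> (cmod (M$2$1 * z + M$2$2))\<^sup>2 + (cmod (M$2$1))\<^sup>2 * t\<^sup>2)"
proof -
  define J where "J = {M \<in> SL2_O11. M$2$1 \<in> principal p \<and> M$2$1 \<noteq> 0}"
  have "PGamma0 p - stab_inf (PGamma0 p) = {g \<in> PGamma0 p. psl_ext_act g None \<noteq> None}"
    by (auto simp: stab_inf_def)
  also have "\<dots> = psl_of ` J"
  proof -
    have "psl_ext_act (psl_of M) None \<noteq> None \<longleftrightarrow> M$2$1 \<noteq> 0" if "M \<in> SL2_O11" for M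
      using ext_act_infinity[OF SL2_O11D(1)[OF that]] by simp
    then show ?thesis unfolding PGamma0_def J_def by blast
  qed
  finally have "PGamma0 p - stab_inf (PGamma0 p) = psl_of ` J" .
  then have "isometric_spheres (PGamma0 p) = (\<lambda>M. mat_isometric_sphere M) ` J"
    by (simp only: isometric_spheres_def image_image)
      (rule image_cong[OF refl], simp add: J_def psl_of_lift SL2_O11D)
  also have "\<dots> = (\<lambda>(c, r). hemisphere c r) ` (\<lambda>M. (- M$2$2 / M$2$1, 1 / cmod (M$2$1))) ` J"
    by (simp add: image_image mat_isometric_sphere_def)
  finally have eq: "isometric_spheres (PGamma0 p) =
      (\<lambda>(c, r). hemisphere c r) ` (\<lambda>M. (- M$2$2 / M$2$1, 1 / cmod (M$2$1))) ` J" .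
  have "(z, t) \<in> exterior (isometric_spheres (PGamma0 p)) \<longleftrightarrow> t > 0 \<and>
     (\<forall>(c, r)\<in>(\<lambda>M. (- M$2$2 / M$2$1, 1 / cmod (M$2$1))) ` J. r\<^sup>2 \<le> (cmod (z - c))\<^sup>2 + t\<^sup>2)"
    unfolding eq by (rule exterior_hemispheres) (auto simp: J_def)
  then have "(z, t) \<in> exterior (isometric_spheres (PGamma0 p)) \<longleftrightarrow> t > 0 \<and>
     (\<forall>M\<in>J. (1 / cmod (M$2$1))\<^sup>2 \<le> (cmod (z - (- M$2$2 / M$2$1)))\<^sup>2 + t\<^sup>2)"
    unfolding ball_simps prod.case .
  moreover have "(1 / cmod c)\<^sup>2 \<le> (cmod (z - (- d / c)))\<^sup>2 + t\<^sup>2 \<longleftrightarrow>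
      1 \<le> (cmod (c * z + d))\<^sup>2 + (cmod c)\<^sup>2 * t\<^sup>2" if "c \<noteq> 0" for c d
  proof -
    have "c * z + d = c * (z - (- d / c))" using that by (simp add: algebra_simps)
    then have e: "(cmod (c * z + d))\<^sup>2 = (cmod c)\<^sup>2 * (cmod (z - (- d / c)))\<^sup>2"
      by (simp only: norm_mult power_mult_distrib)
    show ?thesis
      unfolding e using that by (simp add: power_divide divide_le_eq algebra_simps)
  qed
  ultimately show ?thesis by (auto simp: J_def)
qed

text \<open>Units have norm 1, and \<open>11 * (n * n) \<le> 4\<close> forces n = 0. For this reason
  the stabilizer of infinity contains nothing but translations.\<close>

lemma O11_unit:
  assumes "a \<in> carrier O11" "d \<in> carrier O11" "a * d = 1"
  shows "a = 1 \<or> a = - 1"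
proof -
  have "a \<noteq> 0" "d \<noteq> 0" using assms by auto
  then have n: "1 \<le> (cmod a)\<^sup>2" "1 \<le> (cmod d)\<^sup>2" using O11_cmod_ge_1 assms by auto
  have "(cmod a)\<^sup>2 * (cmod d)\<^sup>2 = 1"
    using assms(3) by (metis norm_mult norm_one power_mult_distrib power_one)
  then have a1: "(cmod a)\<^sup>2 \<le> 1" using n mult_left_mono[OF n(2), of "(cmod a)\<^sup>2"] by simp
  obtain m n where a: "a = of_int m + of_int n * \<omega>" using assms by (auto simp: O11_iff)
  have q: "qnorm m n = 1" using a1 n(1) unfolding a cmod_O11 by linarith
  then have "n * n < 1 * 1" using qnorm_bounds(2)[where m=m and n=n] by linarith
  then have "n = 0" using sq_lt_imp[of n 1] by simp
  then have "m * m = 1" using q by (simp add: qnorm_def)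
  then have "m = 1 \<or> m = -1" by (simp add: square_eq_1_iff)
  then show ?thesis using \<open>n = 0\<close> a by auto
qed

lemma psl_of_minus: "det M = 1 \<Longrightarrow> psl_of (- M) = psl_of M"
  unfolding psl_of_def by (rule Quotient3_rel_abs[OF Quotient3_psl2c]) (simp add: psl_rel_def det_2)

lemma stab_inf_PGamma0:
  "stab_inf (PGamma0 p) = (\<lambda>b. psl_of (mat2 1 b 0 1)) ` carrier O11"
proof (intro equalityI subsetI)
  fix g assume "g \<in> stab_inf (PGamma0 p)"
  then obtain M where M: "M \<in> SL2_O11" "g = psl_of M" "M$2$1 = 0"
    by (auto simp: stab_inf_def PGamma0_def ext_act_infinity SL2_O11D)
  have ad: "M$1$1 * M$2$2 = 1" using SL2_O11D(2)[OF M(1)] M(3) by simp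
  consider "M$1$1 = 1" | "M$1$1 = - 1" using O11_unit[OF SL2_O11D(3)[OF M(1)] SL2_O11D(3)[OF M(1)] ad] by blast
  then show "g \<in> (\<lambda>b. psl_of (mat2 1 b 0 1)) ` carrier O11"
  proof cases
    case 1
    then have "M = mat2 1 (M$1$2) 0 1" using M(3) ad by (intro mat2_eqI) auto
    then have "g = psl_of (mat2 1 (M$1$2) 0 1)" unfolding M(2) by (rule arg_cong)
    then show ?thesis using SL2_O11D(3)[OF M(1)] by (rule image_eqI)
  next
    case 2
    then have "M$2$2 = - 1" using ad by (simp add: minus_equation_iff)
    then have "M = - mat2 1 (- M$1$2) 0 1" using 2 M(3) by (intro mat2_eqI) auto
    then have "g = psl_of (- mat2 1 (- M$1$2) 0 1)" unfolding M(2) by (rule arg_cong)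
    also have "\<dots> = psl_of (mat2 1 (- M$1$2) 0 1)"
      by (rule psl_of_minus) simp
    finally show ?thesis
      using O11_uminus[OF SL2_O11D(3)[OF M(1)]] by (rule image_eqI)
  qed
next
  fix g assume "g \<in> (\<lambda>b. psl_of (mat2 1 b 0 1)) ` carrier O11"
  then obtain b where b: "b \<in> carrier O11" "g = psl_of (mat2 1 b 0 1)" by blast
  then have "mat2 1 b 0 1 \<in> SL2_O11" by (auto simp: SL2_O11_mat2 intro: O11_closed)
  moreover have "0 \<in> principal p" unfolding principal_iff by (rule bexI[of _ 0]) (auto intro: O11_closed)
  ultimately show "g \<in> stab_inf (PGamma0 p)"
    unfolding stab_inf_def PGamma0_def using b(2) by (auto simp: ext_act_infinity)
qed

lemma psl_act_translation: "psl_act (psl_of (mat2 1 b 0 1)) = (\<lambda>x. (b, 0) + x)"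
proof -
  have "det (mat2 1 b 0 1) = 1" by simp
  from psl_of_lift(1)[OF this] show ?thesis
    by (auto simp: fun_eq_iff mat_act_def)
qed

lemma translation_hemisphere:
  "(\<lambda>x. (b, 0) + x) ` hemisphere z r = hemisphere (b + z) r"
proof -
  have "(\<lambda>x. (b, 0 :: real) + x) ` H3 = H3"
  proof (intro equalityI subsetI)
    fix x assume "x \<in> H3"
    then have "x - (b, 0) \<in> H3" "x = (b, 0) + (x - (b, 0))" by (auto simp: H3_def)
    then show "x \<in> (\<lambda>x. (b, 0) + x) ` H3" by blast
  qed (auto simp: H3_def)
  then show ?thesis
    unfolding hemisphere_def by (simp add: image_Int sphere_translation[symmetric])
qed

lemma exterior_sphere_collection:
  assumes p: "p > 0"
  shows "(z, t) \<in> exterior (sphere_collection p) \<longleftrightarrow> t > 0 \<and>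
     (\<forall>\<alpha>\<in>carrier O11 - principal p. (1 / real p)\<^sup>2 \<le> (cmod (z - \<alpha> / of_nat p))\<^sup>2 + t\<^sup>2) \<and>
     (\<forall>b\<in>carrier O11. \<forall>\<mu>\<in>{\<omega>, - \<omega>, \<omega> + 1, - (\<omega> + 1)}.
        (1 / (real p * sqrt 3))\<^sup>2 \<le> (cmod (z - (b - 1 / (of_nat p * \<mu>))))\<^sup>2 + t\<^sup>2)"
proof -
  \<comment> \<open>Inverting the lower triangular matrices negates the lower left entry, so the
    inverses are accounted for by the negatives of \<omega> and \<omega> + 1.\<close>
  define MU where "MU = {\<omega>, - \<omega>, \<omega> + 1, - (\<omega> + 1)}"
  define I1 where "I1 = (\<lambda>\<alpha>. (\<alpha> / of_nat p, 1 / real p)) ` (carrier O11 - principal p)"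
  define I2 where "I2 = (\<lambda>(b, \<mu>). (b - 1 / (of_nat p * \<mu>), 1 / (real p * sqrt 3))) `
    (carrier O11 \<times> MU)"
  have iso: "(\<lambda>x. (b, 0) + x) ` isometric_sphere (psl_of (mat2 1 0 (of_nat p * \<mu>) 1)) =
      hemisphere (b - 1 / (of_nat p * \<mu>)) (1 / (real p * sqrt 3))"
    if "\<mu> \<in> MU" for b \<mu>
  proof -
    have m: "cmod \<mu> = sqrt 3"
      using that cmod_omega norm_minus_cancel unfolding MU_def by (metis empty_iff insert_iff)
    then have "\<mu> \<noteq> 0" by auto
    then show ?thesis using p by (simp add: isometric_sphere_lower norm_mult m translation_hemisphere)
  qed
  have N: "(\<exists>M\<in>{mat2 1 0 (of_nat p * \<omega>) 1, mat2 1 0 (of_nat p * (\<omega> + 1)) 1}. N = M \<or> N = matrix_inv M) \<longleftrightarrow>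
    N \<in> (\<lambda>\<mu>. mat2 1 0 (of_nat p * \<mu>) 1) ` MU" for N
    unfolding MU_def
    by (simp only: matrix_inv_lower bex_simps image_insert image_empty insert_iff empty_iff mult_minus_right
        disj_assoc simp_thms)
  have gen: "{F g N |g N. g \<in> f ` A \<and> N \<in> h ` B} = (\<lambda>(b, \<mu>). F (f b) (h \<mu>)) ` (A \<times> B)"
    for F :: "psl2c \<Rightarrow> complex^2^2 \<Rightarrow> (complex \<times> real) set" and f h and A B :: "complex set"
    by (auto simp: image_def)
  have "(\<lambda>(b, \<mu>). (\<lambda>x. (b, 0) + x) ` isometric_sphere (psl_of (mat2 1 0 (of_nat p * \<mu>) 1))) `
      (carrier O11 \<times> MU) = (\<lambda>(c, r). hemisphere c r) ` I2"
    unfolding I2_def image_image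
  proof (intro image_cong refl)
    fix x assume "x \<in> carrier O11 \<times> MU"
    then show "(case x of (b, \<mu>) \<Rightarrow> (\<lambda>x. (b, 0) + x) ` isometric_sphere (psl_of (mat2 1 0 (of_nat p * \<mu>) 1))) =
      (case case x of (b, \<mu>) \<Rightarrow> (b - 1 / (of_nat p * \<mu>), 1 / (real p * sqrt 3)) of (c, r) \<Rightarrow> hemisphere c r)"
      using iso by (cases x) (simp only: mem_Sigma_iff prod.case)
  qed
  then have "sphere_collection p = (\<lambda>(c, r). hemisphere c r) ` (I1 \<union> I2)"
    unfolding sphere_collection_def N stab_inf_PGamma0 gen[of "\<lambda>g N. psl_act g ` isometric_sphere (psl_of N)"]
      psl_act_translation image_Un I1_def
    by (simp only: image_image prod.case Setcompr_eq_image)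
  then have "(z, t) \<in> exterior (sphere_collection p) \<longleftrightarrow>
      t > 0 \<and> (\<forall>(c, r)\<in>I1 \<union> I2. r\<^sup>2 \<le> (cmod (z - c))\<^sup>2 + t\<^sup>2)"
    by (simp only:) (rule exterior_hemispheres, use p in \<open>auto simp: I1_def I2_def\<close>)
  moreover have "(\<forall>(c, r)\<in>I1. r\<^sup>2 \<le> (cmod (z - c))\<^sup>2 + t\<^sup>2) \<longleftrightarrow>
     (\<forall>\<alpha>\<in>carrier O11 - principal p. (1 / real p)\<^sup>2 \<le> (cmod (z - \<alpha> / of_nat p))\<^sup>2 + t\<^sup>2)"
    unfolding I1_def ball_simps prod.case ..
  moreover have "(\<forall>(c, r)\<in>I2. r\<^sup>2 \<le> (cmod (z - c))\<^sup>2 + t\<^sup>2) \<longleftrightarrow>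
     (\<forall>b\<in>carrier O11. \<forall>\<mu>\<in>MU.
        (1 / (real p * sqrt 3))\<^sup>2 \<le> (cmod (z - (b - 1 / (of_nat p * \<mu>))))\<^sup>2 + t\<^sup>2)"
    unfolding I2_def ball_simps by (simp only: split_paired_Ball_Sigma prod.case)
  ultimately show ?thesis unfolding MU_def[symmetric] by (simp only: ball_Un)
qed

section \<open>The exterior of the isometric spheres\<close>

lemma cmod_add_sq: "(cmod (u + v))\<^sup>2 = (cmod u)\<^sup>2 + (cmod v)\<^sup>2 + 2 * Re (u * cnj v)"
  unfolding cmod_power2 by (simp add: power2_eq_square algebra_simps)

lemma cmod_diff_sq: "(cmod (u - v))\<^sup>2 = (cmod u)\<^sup>2 + (cmod v)\<^sup>2 - 2 * Re (u * cnj v)"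
  unfolding cmod_power2 by (simp add: power2_eq_square algebra_simps)

lemma principal_add: "x \<in> principal p \<Longrightarrow> y \<in> principal p \<Longrightarrow> x + y \<in> principal p"
  unfolding principal_iff by (metis O11_add distrib_left)

lemma principal_mult: "x \<in> principal p \<Longrightarrow> y \<in> carrier O11 \<Longrightarrow> x * y \<in> principal p"
  unfolding principal_iff by (metis O11_mult mult.assoc)

lemma principal_O11: "x \<in> principal p \<Longrightarrow> x \<in> carrier O11"
  unfolding principal_iff by (auto intro: O11_closed)

lemma one_notin_principal:
  assumes "p > 1"
  shows "1 \<notin> principal p"
proof
  assume "1 \<in> principal p"
  then obtain y where y: "y \<in> carrier O11" "1 = of_nat p * y" by (auto simp: principal_iff)
  then have "y \<noteq> 0" by auto
  then have y1: "1 \<le> (cmod y)\<^sup>2" using O11_cmod_ge_1 y by blast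
  have "1 = (real p)\<^sup>2 * (cmod y)\<^sup>2"
    using arg_cong[OF y(2), of "\<lambda>x. (cmod x)\<^sup>2"] by (simp add: norm_mult power_mult_distrib)
  moreover have "(real p)\<^sup>2 * 1 \<le> (real p)\<^sup>2 * (cmod y)\<^sup>2" using y1 by (intro mult_left_mono) auto
  ultimately have "(real p)\<^sup>2 \<le> 1" by simp
  then show False using assms by (simp add: power_le_one_iff)
qed

lemma principal_translate:
  assumes "l \<in> principal p" "x \<in> carrier O11" "x \<notin> principal p"
  shows "l + x \<in> carrier O11 - principal p"
proof -
  have "- l \<in> principal p" using principal_mult[OF assms(1) O11_int[of "-1"]] by simp
  then have "l + x \<notin> principal p" using principal_add[of "- l" p "l + x"] assms(3) by auto
  then show ?thesis using assms by (auto intro: O11_add principal_O11)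
qed

text \<open>If p divided the norm of \<alpha>, the prime ideal would contain \<alpha> or its
  conjugate, hence \<alpha>, being stable under conjugation. So the norm is prime to p, and a Bezout
  relation over the integers yields an inverse that is a multiple of
  \<open>cnj \<alpha>\<close>.\<close>

lemma inverse_mod_inert:
  assumes p: "prime p" and inert: "inert p" and a: "\<alpha> \<in> carrier O11" "\<alpha> \<notin> principal p"
  obtains \<beta> k where "\<beta> \<in> carrier O11" "k \<in> carrier O11" "\<alpha> * \<beta> - of_nat p * k = 1"
proof -
  interpret primeideal "principal p" O11 using inert by (simp add: inert_def)
  obtain m n where mn: "\<alpha> = of_int m + of_int n * \<omega>" using a by (auto simp: O11_iff)
  define N where "N = qnorm m n"
  have norm: "\<alpha> * cnj \<alpha> = of_int N"
    unfolding complex_norm_square[symmetric] N_def mn cmod_O11 by simp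
  have "\<not> int p dvd N"
  proof
    assume "int p dvd N"
    then obtain k where "N = int p * k" by (auto elim: dvdE)
    then have "\<alpha> * cnj \<alpha> = of_nat p * of_int k" using norm by simp
    then have "\<alpha> * cnj \<alpha> \<in> principal p" unfolding principal_iff using O11_int by blast
    then have "\<alpha> \<in> principal p \<or> cnj \<alpha> \<in> principal p"
      using I_prime[of \<alpha> "cnj \<alpha>"] a O11_cnj[OF a(1)] by (simp add: O11_def)
    moreover have "\<alpha> \<in> principal p" if cnj: "cnj \<alpha> \<in> principal p"
    proof -
      obtain y where y: "y \<in> carrier O11" "cnj \<alpha> = of_nat p * y"
        using cnj unfolding principal_iff by blast
      then have "\<alpha> = of_nat p * cnj y"
        by (metis complex_cnj_cnj complex_cnj_mult complex_cnj_of_nat)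
      then show ?thesis unfolding principal_iff using O11_cnj[OF y(1)] by blast
    qed
    ultimately show False using a by blast
  qed
  then have "coprime (int p) N" using p by (intro prime_imp_coprime) auto
  then obtain u v where uv: "u * int p + v * N = 1"
    using bezout_int[of "int p" N] by (auto simp: coprime_iff_gcd_eq_1)
  show ?thesis
  proof
    show "of_int v * cnj \<alpha> \<in> carrier O11" "of_int (- u) \<in> carrier O11"
      by (intro O11_mult O11_int O11_cnj a)+
    have "\<alpha> * (of_int v * cnj \<alpha>) - of_nat p * of_int (- u) = of_int v * (\<alpha> * cnj \<alpha>) + of_nat p * of_int u"
      by (simp add: algebra_simps)
    also have "\<dots> = of_int (u * int p + v * N)" unfolding norm by simp
    finally show "\<alpha> * (of_int v * cnj \<alpha>) - of_nat p * of_int (- u) = 1" unfolding uv by simp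
  qed
qed

text \<open>Every sphere of the collection is isometric for some element of the group. For the
  spheres around \<alpha> / p the bottom row (p, -\<alpha>) is completed to determinant 1 by means
  of \<open>inverse_mod_inert\<close>.\<close>

lemma exterior_isometric_subset_collection:
  assumes p: "prime p" and inert: "inert p"
  shows "exterior (isometric_spheres (PGamma0 p)) \<subseteq> exterior (sphere_collection p)"
proof clarify
  fix z t assume "(z, t) \<in> exterior (isometric_spheres (PGamma0 p))"
  then have t: "t > 0" and iso: "\<And>M. M \<in> SL2_O11 \<Longrightarrow> M$2$1 \<in> principal p \<Longrightarrow> M$2$1 \<noteq> 0 \<Longrightarrow>
       1 \<le> (cmod (M$2$1 * z + M$2$2))\<^sup>2 + (cmod (M$2$1))\<^sup>2 * t\<^sup>2"
    unfolding exterior_isometric_spheres by blast+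
  have p0: "p > 0" using p by (simp add: prime_gt_0_nat)
  have conv: "(1 / cmod c)\<^sup>2 \<le> (cmod (z - x))\<^sup>2 + t\<^sup>2"
    if "1 \<le> (cmod (c * z + d))\<^sup>2 + (cmod c)\<^sup>2 * t\<^sup>2" "c \<noteq> 0" "c * x = - d" for c d x
  proof -
    have "c * z + d = c * (z - x)" using that(3) by (simp add: algebra_simps)
    then have e: "(cmod (c * z + d))\<^sup>2 = (cmod c)\<^sup>2 * (cmod (z - x))\<^sup>2"
      by (simp only: norm_mult power_mult_distrib)
    show ?thesis
      using that(1,2) unfolding e by (simp add: power_divide divide_le_eq algebra_simps)
  qed
  show "(z, t) \<in> exterior (sphere_collection p)"
    unfolding exterior_sphere_collection[OF p0]
  proof (intro conjI ballI t)
    fix \<alpha> assume a: "\<alpha> \<in> carrier O11 - principal p"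
    then obtain \<beta> k where bk: "\<beta> \<in> carrier O11" "k \<in> carrier O11" "\<alpha> * \<beta> - of_nat p * k = 1"
      using inverse_mod_inert[OF p inert] by blast
    have "mat2 (- \<beta>) k (of_nat p) (- \<alpha>) \<in> SL2_O11"
      unfolding SL2_O11_mat2
    proof
      show "- \<beta> * - \<alpha> - k * of_nat p = 1" using bk(3) by (simp add: mult.commute)
      show "{- \<beta>, k, of_nat p, - \<alpha>} \<subseteq> carrier O11"
        using bk a O11_int[of "int p"] O11_uminus by simp
    qed
    moreover have "of_nat p \<in> principal p"
      unfolding principal_iff by (rule bexI[of _ 1]) (use O11_int[of 1] in simp_all)
    ultimately have "1 \<le> (cmod (of_nat p * z + (- \<alpha>)))\<^sup>2 + (cmod (of_nat p))\<^sup>2 * t\<^sup>2"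
      using iso[of "mat2 (- \<beta>) k (of_nat p) (- \<alpha>)"] p0 by simp
    from conv[OF this, of "\<alpha> / of_nat p"] p0
    show "(1 / real p)\<^sup>2 \<le> (cmod (z - \<alpha> / of_nat p))\<^sup>2 + t\<^sup>2" by simp
  next
    fix b \<mu> assume b: "b \<in> carrier O11" and m: "\<mu> \<in> {\<omega>, - \<omega>, \<omega> + 1, - (\<omega> + 1)}"
    have c: "cmod \<mu> = sqrt 3"
      using m cmod_omega norm_minus_cancel by (metis empty_iff insert_iff)
    have mO: "\<mu> \<in> carrier O11" using m O11_omega O11_int[of 1] by (auto intro: O11_uminus O11_add O11_diff)
    have m0: "\<mu> \<noteq> 0" using c by auto
    have pm: "of_nat p * \<mu> \<in> principal p" unfolding principal_iff using mO by blast
    \<comment> \<open>The lower triangular matrix times the translation by -b on its right; the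
      isometric sphere is thereby moved by b.\<close>
    have "mat2 1 (- b) (of_nat p * \<mu>) (1 - of_nat p * \<mu> * b) \<in> SL2_O11"
      unfolding SL2_O11_mat2
    proof
      have "1 - of_nat p * \<mu> * b \<in> carrier O11"
        using O11_diff[OF O11_int[of 1] O11_mult[OF principal_O11[OF pm] b]] by simp
      then show "{1, - b, of_nat p * \<mu>, 1 - of_nat p * \<mu> * b} \<subseteq> carrier O11"
        using O11_int[of 1] O11_uminus[OF b] principal_O11[OF pm] by simp
    qed (simp add: algebra_simps)
    then have "1 \<le> (cmod (of_nat p * \<mu> * z + (1 - of_nat p * \<mu> * b)))\<^sup>2 + (cmod (of_nat p * \<mu>))\<^sup>2 * t\<^sup>2"
      using iso[of "mat2 1 (- b) (of_nat p * \<mu>) (1 - of_nat p * \<mu> * b)"] pm p0 m0 by simp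
    from conv[OF this, of "b - 1 / (of_nat p * \<mu>)"] p0 m0
    show "(1 / (real p * sqrt 3))\<^sup>2 \<le> (cmod (z - (b - 1 / (of_nat p * \<mu>))))\<^sup>2 + t\<^sup>2"
      by (simp add: norm_mult c algebra_simps)
  qed
qed

text \<open>Over the hexagon around \<open>l\<close> only finitely many spheres matter: the one around \<open>l\<close> if \<open>l\<close> is
  not a multiple of \<open>p\<close>, and otherwise six spheres through the cusp \<open>l / p\<close>, whose exterior the
  inversion in this cusp turns into \<open>hex\<close>.\<close>

lemma collection_unit_sphere:
  assumes p: "p > 0" and ext: "(z, t) \<in> exterior (sphere_collection p)"
    and l: "l \<in> carrier O11 - principal p"
  shows "1 \<le> (cmod (of_nat p * z - l))\<^sup>2 + (real p * t)\<^sup>2"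
proof -
  have "(1 / real p)\<^sup>2 \<le> (cmod (z - l / of_nat p))\<^sup>2 + t\<^sup>2"
    using ext l unfolding exterior_sphere_collection[OF p] by blast
  then have "(real p)\<^sup>2 * (1 / real p)\<^sup>2 \<le> (real p)\<^sup>2 * ((cmod (z - l / of_nat p))\<^sup>2 + t\<^sup>2)"
    by (intro mult_left_mono) auto
  moreover have "of_nat p * z - l = of_nat p * (z - l / of_nat p)" using p by (simp add: algebra_simps)
  ultimately show ?thesis using p by (simp add: norm_mult power_mult_distrib power_divide distrib_left)
qed

lemma collection_cusp_spheres:
  assumes p: "p > 1" and ext: "(z, t) \<in> exterior (sphere_collection p)" and l: "l \<in> principal p"
  shows "of_nat p * z - l \<in> hex ((cmod (of_nat p * z - l))\<^sup>2 + (real p * t)\<^sup>2)"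
proof -
  define w s where "w = of_nat p * z - l" and "s = (cmod w)\<^sup>2 + (real p * t)\<^sup>2"
  have p0: "p > 0" using p by simp
  \<comment> \<open>The neighbours l + 1 and l - 1 of the cusp are not in
    \<open>principal p\<close>, so their unit spheres are available; they pass through the cusp and
    supply the two inverted walls for \<beta> = 1 and -1.\<close>
  have "1 \<le> (cmod (w - e))\<^sup>2 + (real p * t)\<^sup>2" if "e \<in> {1, - 1}" for e
  proof -
    have "e \<in> carrier O11" using that by (auto intro: O11_closed)
    moreover have "e \<notin> principal p"
      using that one_notin_principal[OF p] principal_mult[of "- 1" p "of_int (- 1)"] O11_int[of "-1"]
      by auto
    ultimately show ?thesis
      using collection_unit_sphere[OF p0 ext principal_translate[OF l]] by (simp add: w_def diff_diff_eq)
  qed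
  from this[of 1] this[of "- 1"] have x: "2 * \<bar>Re w\<bar> \<le> s"
    unfolding s_def cmod_diff_sq by (simp add: abs_if)
  obtain b where b: "b \<in> carrier O11" "l = of_nat p * b" using l by (auto simp: principal_iff)
  \<comment> \<open>Multiplied by 9 p^2 and rewritten with 3 / \<mu> = \<open>cnj \<mu>\<close>, the
    condition is |3 w + \<open>cnj \<mu>\<close>|^2 + 9 (p t)^2 \<ge> 3. The constant 3 cancels
    because the sphere passes through the cusp, leaving an inverted wall.\<close>
  have m: "0 \<le> 3 * s + 2 * Re (w * \<mu>)" if m: "\<mu> \<in> {\<omega>, - \<omega>, \<omega> + 1, - (\<omega> + 1)}" for \<mu>
  proof -
    have "cmod \<mu> = sqrt 3"
      using m cmod_omega norm_minus_cancel by (metis empty_iff insert_iff)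
    then have c: "(cmod \<mu>)\<^sup>2 = 3" by simp
    then have m0: "\<mu> \<noteq> 0" by auto
    have inv: "\<mu> * cnj \<mu> = 3" unfolding complex_norm_square[symmetric] c by simp
    have "(1 / (real p * sqrt 3))\<^sup>2 \<le> (cmod (z - (b - 1 / (of_nat p * \<mu>))))\<^sup>2 + t\<^sup>2"
      using ext b m unfolding exterior_sphere_collection[OF p0] by blast
    then have "(3 * real p)\<^sup>2 * (1 / (real p * sqrt 3))\<^sup>2 \<le>
        (3 * real p)\<^sup>2 * ((cmod (z - (b - 1 / (of_nat p * \<mu>))))\<^sup>2 + t\<^sup>2)"
      by (intro mult_left_mono) auto
    then have "3 \<le> (cmod (3 * of_nat p * (z - (b - 1 / (of_nat p * \<mu>)))))\<^sup>2 + 9 * (real p * t)\<^sup>2"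
      using p0 by (simp add: power_divide power_mult_distrib norm_mult distrib_left)
    moreover have "3 * of_nat p * (z - (b - 1 / (of_nat p * \<mu>))) = 3 * w + 3 / \<mu>"
      using p0 m0 by (simp add: w_def b(2) field_simps)
    moreover have "3 / \<mu> = cnj \<mu>" using inv m0 by (simp add: field_simps)
    moreover have "(cmod (3 * w + cnj \<mu>))\<^sup>2 = 9 * (cmod w)\<^sup>2 + 3 + 6 * Re (w * \<mu>)"
      unfolding cmod_add_sq using c by (simp add: norm_mult power_mult_distrib)
    ultimately show ?thesis by (simp add: s_def)
  qed
  have "\<bar>Re w\<bar> + sqrt 11 * \<bar>Im w\<bar> \<le> 3 * s"
  proof -
    have "Re (w * \<omega>) = - Re w / 2 - sqrt 11 * Im w / 2" by (simp add: \<omega>_def)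
    moreover have "Re (w * (\<omega> + 1)) = Re w / 2 - sqrt 11 * Im w / 2" by (simp add: \<omega>_def)
    moreover have "sqrt 11 * \<bar>Im w\<bar> = \<bar>sqrt 11 * Im w\<bar>" by (simp add: abs_mult)
    moreover have "0 \<le> 3 * s + 2 * Re (w * \<omega>)" "0 \<le> 3 * s + - (2 * Re (w * \<omega>))"
      "0 \<le> 3 * s + 2 * Re (w * (\<omega> + 1))" "0 \<le> 3 * s + - (2 * Re (w * (\<omega> + 1)))"
      using m[of \<omega>] m[of "- \<omega>"] m[of "\<omega> + 1"] m[of "- (\<omega> + 1)"]
      by (simp_all only: mult_minus_right uminus_complex.sel insert_iff simp_thms)
    ultimately show ?thesis by linarith
  qed
  then show ?thesis using x unfolding hex_def w_def s_def by blast
qed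

text \<open>In the coordinate w around l, with s = |w|^2 + (p t)^2, the claim reads |\<gamma>|^2 s +
  |d|^2 + 2 Re (\<gamma> w \<open>cnj d\<close>) \<ge> 1. If s \<ge> 1, \<open>hex_reduced\<close>
  at w suffices. If s < 1, it is applied at w / s and multiplied by s; what is then missing is
  \<open>(1 - s) * ((cmod d)\<^sup>2 - 1) \<ge> 0\<close>, that is d \<noteq> 0. With l in
  \<open>principal p\<close>, a vanishing d would put the whole bottom row into this proper ideal,
  contradicting determinant 1.\<close>

lemma isometric_of_cell:
  assumes p: "p > 1" and t: "t > 0" and l: "l \<in> carrier O11"
    and w: "of_nat p * z - l \<in> hex 1"
    and cell: "1 \<le> (cmod (of_nat p * z - l))\<^sup>2 + (real p * t)\<^sup>2 \<or>
      l \<in> principal p \<and> of_nat p * z - l \<in> hex ((cmod (of_nat p * z - l))\<^sup>2 + (real p * t)\<^sup>2)"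
  shows "(z, t) \<in> exterior (isometric_spheres (PGamma0 p))"
  unfolding exterior_isometric_spheres
proof (intro conjI ballI impI t)
  fix M assume M: "M \<in> SL2_O11" and c: "M$2$1 \<in> principal p \<and> M$2$1 \<noteq> 0"
  define w s where "w = of_nat p * z - l" and "s = (cmod w)\<^sup>2 + (real p * t)\<^sup>2"
  obtain \<gamma> where g: "\<gamma> \<in> carrier O11" "M$2$1 = of_nat p * \<gamma>" using c by (auto simp: principal_iff)
  then have g0: "\<gamma> \<noteq> 0" using c by auto
  then have g1: "1 \<le> (cmod \<gamma>)\<^sup>2" using O11_cmod_ge_1 g by blast
  define d where "d = M$2$2 + \<gamma> * l"
  have d: "d \<in> carrier O11" unfolding d_def by (intro O11_closed SL2_O11D(3) M g l)
  have s0: "s > 0" using p t unfolding s_def by (simp add: add_nonneg_pos)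
  have "M$2$1 * z + M$2$2 = \<gamma> * w + d" unfolding g(2) d_def w_def by (simp add: algebra_simps)
  then have "(cmod (M$2$1 * z + M$2$2))\<^sup>2 =
      (cmod \<gamma>)\<^sup>2 * (cmod w)\<^sup>2 + (cmod d)\<^sup>2 + 2 * Re (\<gamma> * w * cnj d)"
    by (simp only: cmod_add_sq norm_mult power_mult_distrib)
  moreover have "(cmod (M$2$1))\<^sup>2 * t\<^sup>2 = (cmod \<gamma>)\<^sup>2 * (real p * t)\<^sup>2"
    unfolding g(2) by (simp add: norm_mult power_mult_distrib)
  ultimately have f: "(cmod (M$2$1 * z + M$2$2))\<^sup>2 + (cmod (M$2$1))\<^sup>2 * t\<^sup>2 =
      (cmod \<gamma>)\<^sup>2 * s + (cmod d)\<^sup>2 + 2 * Re (\<gamma> * w * cnj d)"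
    unfolding s_def distrib_left by linarith
  show "1 \<le> (cmod (M$2$1 * z + M$2$2))\<^sup>2 + (cmod (M$2$1))\<^sup>2 * t\<^sup>2"
  proof (cases "1 \<le> s")
    case True
    have "0 \<le> (cmod \<gamma>)\<^sup>2 + (cmod d)\<^sup>2 - 1 + 2 * Re (\<gamma> * w * cnj d)"
      using hex_reduced[OF _ g(1) g0 d] w unfolding w_def by blast
    moreover have "(cmod \<gamma>)\<^sup>2 * 1 \<le> (cmod \<gamma>)\<^sup>2 * s" using True by (intro mult_left_mono) auto
    ultimately show ?thesis unfolding f by linarith
  next
    case False
    then have lp: "l \<in> principal p" and h: "w \<in> hex s" using cell unfolding s_def w_def by auto
    have "d \<noteq> 0"
    proof
      assume "d = 0"
      then have "M$2$2 = l * (- \<gamma>)" unfolding d_def by (simp add: add_eq_0_iff mult.commute)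
      then have "M$2$2 \<in> principal p" using principal_mult[OF lp O11_uminus[OF g(1)]] by simp
      then have "M$2$2 * M$1$1 + M$2$1 * (- M$1$2) \<in> principal p"
        using c by (intro principal_add principal_mult O11_uminus SL2_O11D(3) M) auto
      moreover have "M$2$2 * M$1$1 + M$2$1 * (- M$1$2) = 1"
        using SL2_O11D(2)[OF M] by (simp add: mult.commute)
      ultimately show False using one_notin_principal[OF p] by simp
    qed
    then have d1: "1 \<le> (cmod d)\<^sup>2" using O11_cmod_ge_1 d by blast
    have "0 \<le> (cmod \<gamma>)\<^sup>2 + (cmod d)\<^sup>2 - 1 + 2 * Re (\<gamma> * (w / of_real s) * cnj d)"
      using hex_reduced[OF _ g(1) g0 d] h hex_divide[OF s0] by blast
    moreover have "Re (\<gamma> * (w / of_real s) * cnj d) = Re (\<gamma> * w * cnj d) / s"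
      by (metis Re_divide_of_real times_divide_eq_left times_divide_eq_right)
    ultimately have "0 \<le> s * ((cmod \<gamma>)\<^sup>2 + (cmod d)\<^sup>2 - 1 + 2 * (Re (\<gamma> * w * cnj d) / s))"
      using s0 by simp
    also have "\<dots> = s * (cmod \<gamma>)\<^sup>2 + s * (cmod d)\<^sup>2 - s + 2 * Re (\<gamma> * w * cnj d)"
      using s0 by (simp add: field_simps)
    finally have "0 \<le> \<dots>" .
    moreover have "0 \<le> (1 - s) * ((cmod d)\<^sup>2 - 1)" using False d1 by simp
    ultimately show ?thesis unfolding f by (simp add: algebra_simps)
  qed
qed

lemma exterior_eq:
  assumes p: "prime p" and inert: "inert p"
  shows "exterior (isometric_spheres (PGamma0 p)) = exterior (sphere_collection p)"
proof
  show "exterior (sphere_collection p) \<subseteq> exterior (isometric_spheres (PGamma0 p))"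
  proof clarify
    fix z t assume ext: "(z, t) \<in> exterior (sphere_collection p)"
    have p1: "p > 1" and p0: "p > 0" using p prime_gt_1_nat prime_gt_0_nat by auto
    then have t: "t > 0" using ext exterior_sphere_collection by blast
    obtain l where l: "l \<in> carrier O11" "of_nat p * z - l \<in> hex 1" using hex_tiling by blast
    show "(z, t) \<in> exterior (isometric_spheres (PGamma0 p))"
      using isometric_of_cell[OF p1 t l] collection_unit_sphere[OF p0 ext, of l]
        collection_cusp_spheres[OF p1 ext, of l] l by blast
  qed
qed (rule exterior_isometric_subset_collection[OF assms])

section \<open>Hyperbolic convex hulls over the hexagons\<close>

text \<open>The walls as bisectors of 0 and its six neighbours, in the shape of half-spaces: s = 1
  gives vertical planes, s = |w|^2 + t^2 gives hemispheres through 0.\<close>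

lemma hex_halfspaces:
  "w \<in> hex s \<longleftrightarrow> (\<forall>\<beta>\<in>{1, - 1, \<omega>, - \<omega>, \<omega> + 1, - (\<omega> + 1)}. 0 \<le> (cmod \<beta>)\<^sup>2 * s + 2 * Re (cnj \<beta> * w))"
proof -
  have c: "(cmod \<omega>)\<^sup>2 = 3" "(cmod (\<omega> + 1))\<^sup>2 = 3" "(cmod (- (\<omega> + 1)))\<^sup>2 = 3"
    unfolding norm_minus_cancel cmod_omega by simp_all
  define x y where "x = Re w" and "y = sqrt 11 * Im w"
  have \<omega>: "2 * Re (cnj \<omega> * w) = - x + y" "2 * Re (cnj (\<omega> + 1) * w) = x + y"
    by (simp_all add: \<omega>_def x_def y_def field_simps)
  have m: "2 * Re (cnj (- \<beta>) * w) = - (2 * Re (cnj \<beta> * w))" for \<beta> by simp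
  have "(\<forall>\<beta>\<in>{1, - 1, \<omega>, - \<omega>, \<omega> + 1, - (\<omega> + 1)}. 0 \<le> (cmod \<beta>)\<^sup>2 * s + 2 * Re (cnj \<beta> * w)) \<longleftrightarrow>
    0 \<le> s + 2 * x \<and> 0 \<le> s + - (2 * x) \<and> 0 \<le> 3 * s + (- x + y) \<and> 0 \<le> 3 * s + - (- x + y) \<and>
    0 \<le> 3 * s + (x + y) \<and> 0 \<le> 3 * s + - (x + y)"
    by (simp only: ball_simps norm_minus_cancel c m \<omega> complex_cnj_one norm_one power_one mult_1
        x_def[symmetric] simp_thms)
  moreover have "w \<in> hex s \<longleftrightarrow> 2 * \<bar>x\<bar> \<le> s \<and> \<bar>x\<bar> + \<bar>y\<bar> \<le> 3 * s"
    unfolding hex_def mem_Collect_eq by (simp add: x_def y_def abs_mult)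
  ultimately show ?thesis by linarith
qed

definition hex_vertices :: "complex set" where
  "hex_vertices = {s * z |s z. s \<in> {1, - 1} \<and> z \<in> {z1, z2, z3}}"

lemma z_coords:
  "Re z1 = 0" "sqrt 11 * Im z1 = 3" "Re z2 = - 1 / 2" "sqrt 11 * Im z2 = 5 / 2"
  "Re z3 = 1 / 2" "sqrt 11 * Im z3 = 5 / 2"
  by (simp_all add: z_alt)

lemma hex_vertices_iff: "v \<in> hex_vertices \<longleftrightarrow> v \<in> {z1, z2, z3, - z1, - z2, - z3}"
proof -
  have "v \<in> hex_vertices \<longleftrightarrow> (\<exists>z\<in>{z1, z2, z3}. v = 1 * z \<or> v = - 1 * z)"
    unfolding hex_vertices_def by blast
  then show ?thesis by auto
qed

lemma hex_vertices_props:
  assumes "v \<in> hex_vertices"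
  shows "v \<in> hex 1" "(cmod v)\<^sup>2 = 9 / 11"
proof -
  have *: "z \<in> hex 1" "(cmod z)\<^sup>2 = 9 / 11" if "z \<in> {z1, z2, z3}" for z
  proof -
    have "sqrt 11 * \<bar>Im z\<bar> = \<bar>sqrt 11 * Im z\<bar>" by (simp add: abs_mult)
    then show "z \<in> hex 1" using that z_coords unfolding hex_def by auto
    have "11 * (cmod z)\<^sup>2 = 11 * (Re z)\<^sup>2 + (sqrt 11 * Im z)\<^sup>2"
      by (simp add: cmod_power2 power_mult_distrib)
    also have "\<dots> = 9"
      using that by (elim insertE emptyE) (simp_all only: z_coords, simp_all add: power2_eq_square)
    finally show "(cmod z)\<^sup>2 = 9 / 11" by simp
  qed
  obtain z where z: "z \<in> {z1, z2, z3}" "v = z \<or> v = - z"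
    using assms unfolding hex_vertices_iff by auto
  show "v \<in> hex 1" using *(1)[OF z(1)] z(2) by (auto simp: hex_def)
  show "(cmod v)\<^sup>2 = 9 / 11" using *(2)[OF z(1)] z(2) by auto
qed

lemma complex_eqI_scaled: "Re z = Re w \<Longrightarrow> sqrt 11 * Im z = sqrt 11 * Im w \<Longrightarrow> z = w"
  by (simp add: complex_eq_iff)

text \<open>The point w lies on the vertical chord from B to T, where T is on the edge from
  \<open>z1\<close> to v and B on the edge from \<open>- z1\<close> to v'. Here v and v' are the
  other vertices on the side of w: 2 Re v is the sign of x, and 2 |x| is the position along the
  edge.\<close>

lemma hex_subset_convex:
  assumes K: "convex K" and V: "hex_vertices \<subseteq> K"
  shows "hex 1 \<subseteq> K"
proof
  fix w assume w: "w \<in> hex 1"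
  define x y where "x = Re w" and "y = sqrt 11 * Im w"
  have "sqrt 11 * \<bar>Im w\<bar> = \<bar>y\<bar>" by (simp add: y_def abs_mult)
  then have h: "2 * \<bar>x\<bar> \<le> 1" "\<bar>x\<bar> + \<bar>y\<bar> \<le> 3" using w by (auto simp: hex_def x_def)
  obtain v v' where v: "v \<in> hex_vertices" "v' \<in> hex_vertices"
    "\<bar>x\<bar> * (2 * Re v) = x" "sqrt 11 * Im v = 5 / 2"
    "\<bar>x\<bar> * (2 * Re v') = x" "sqrt 11 * Im v' = - 5 / 2"
  proof (cases "x \<ge> 0")
    case True
    then show ?thesis
      using that[of z3 "- z2"] z_coords by (simp add: hex_vertices_iff)
  next
    case False
    then show ?thesis
      using that[of z2 "- z3"] z_coords by (simp add: hex_vertices_iff)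
  qed
  have V0: "z1 \<in> K" "- z1 \<in> K" using V by (auto simp: hex_vertices_iff)
  define T where "T = (1 - 2 * \<bar>x\<bar>) *\<^sub>R z1 + (2 * \<bar>x\<bar>) *\<^sub>R v"
  define B where "B = (1 - 2 * \<bar>x\<bar>) *\<^sub>R (- z1) + (2 * \<bar>x\<bar>) *\<^sub>R v'"
  have TB: "T \<in> K" "B \<in> K"
  proof -
    have "v \<in> K" "v' \<in> K" using v V by auto
    then show "T \<in> K" "B \<in> K"
      unfolding T_def B_def by (intro convexD[OF K]; use V0 h in simp)+
  qed
  define r where "r = y / (3 - \<bar>x\<bar>)"
  define \<theta> where "\<theta> = (1 + r) / 2"
  have pos: "3 - \<bar>x\<bar> > 0" using h by linarith
  then have t: "0 \<le> \<theta>" "\<theta> \<le> 1" unfolding \<theta>_def r_def using h by (auto simp: field_simps)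
  have T: "Re T = x" "sqrt 11 * Im T = 3 - \<bar>x\<bar>"
  proof -
    show "Re T = x" using v(3) by (simp add: T_def z_coords algebra_simps)
    have "sqrt 11 * Im T = (1 - 2 * \<bar>x\<bar>) * (sqrt 11 * Im z1) + 2 * \<bar>x\<bar> * (sqrt 11 * Im v)"
      by (simp add: T_def algebra_simps)
    then show "sqrt 11 * Im T = 3 - \<bar>x\<bar>" unfolding z_coords v by (simp add: algebra_simps)
  qed
  have B: "Re B = x" "sqrt 11 * Im B = - (3 - \<bar>x\<bar>)"
  proof -
    show "Re B = x" using v(5) by (simp add: B_def z_coords algebra_simps)
    have "sqrt 11 * Im B = - (1 - 2 * \<bar>x\<bar>) * (sqrt 11 * Im z1) + 2 * \<bar>x\<bar> * (sqrt 11 * Im v')"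
      by (simp add: B_def algebra_simps)
    then show "sqrt 11 * Im B = - (3 - \<bar>x\<bar>)" unfolding z_coords v by (simp add: algebra_simps)
  qed
  have "w = \<theta> *\<^sub>R T + (1 - \<theta>) *\<^sub>R B"
  proof (rule complex_eqI_scaled)
    show "Re w = Re (\<theta> *\<^sub>R T + (1 - \<theta>) *\<^sub>R B)"
      using T B by (simp add: x_def[symmetric] algebra_simps)
    have "sqrt 11 * Im (\<theta> *\<^sub>R T + (1 - \<theta>) *\<^sub>R B) =
        \<theta> * (sqrt 11 * Im T) + (1 - \<theta>) * (sqrt 11 * Im B)"
      by (simp add: algebra_simps)
    also have "\<dots> = (2 * \<theta> - 1) * (3 - \<bar>x\<bar>)" unfolding T B by (simp add: algebra_simps)
    also have "2 * \<theta> - 1 = r" unfolding \<theta>_def by (simp add: field_simps)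
    also have "r * (3 - \<bar>x\<bar>) = y" using pos by (simp add: r_def)
    finally show "sqrt 11 * Im w = sqrt 11 * Im (\<theta> *\<^sub>R T + (1 - \<theta>) *\<^sub>R B)" by (simp add: y_def)
  qed
  then show "w \<in> K" using convexD[OF K TB, of \<theta> "1 - \<theta>"] t by simp
qed

lemma geod_convexD:
  "geod_convex C \<Longrightarrow> P \<in> C \<Longrightarrow> R \<in> C \<Longrightarrow> geod_between P Q R \<Longrightarrow> Q \<in> C"
  unfolding geod_convex_def by blast

text \<open>Vertical projection turns a hemisphere into the Klein disc, whose geodesics are straight.\<close>

lemma convex_hemisphere_projection:
  assumes C: "geod_convex C"
  shows "convex {z. cmod (z - c) < r \<and> Some (z, sqrt (r\<^sup>2 - (cmod (z - c))\<^sup>2)) \<in> C}"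
    (is "convex ?S")
proof (rule convexI)
  fix x y :: complex and a b :: real
  assume x: "x \<in> ?S" and y: "y \<in> ?S" and ab: "0 \<le> a" "0 \<le> b" "a + b = 1"
  define z where "z = a *\<^sub>R x + b *\<^sub>R y"
  have "z \<in> ball c r"
    unfolding z_def using x y ab
    by (intro convexD[OF convex_ball]) (auto simp: dist_norm norm_minus_commute)
  then have zr: "cmod (z - c) < r" by (simp add: dist_norm norm_minus_commute)
  show "a *\<^sub>R x + b *\<^sub>R y \<in> ?S"
  proof (cases "x = y")
    case True
    have "z = (a + b) *\<^sub>R x" unfolding z_def scaleR_add_left True by (rule refl)
    then have "z = x" unfolding ab(3) by simp
    then show ?thesis using x unfolding z_def[symmetric] by simp
  next
    case False
    define D where "D = cmod (y - x)"
    have D: "D > 0" using False by (simp add: D_def)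
    define e where "e = (y - x) / of_real D"
    have e: "cmod e = 1" using D by (simp add: e_def norm_divide D_def)
    have ee: "e * cnj e = 1" unfolding complex_norm_square[symmetric] e by simp
    \<comment> \<open>Orthogonal coordinates along the line through x and y: c + h is the foot of
      the perpendicular from c, e the unit direction, \<sigma> the position of x. Squared distances
      from c are then |h|^2 + \<tau>^2, and L below is half the chord cut out by the circle of
      radius r.\<close>
    define \<sigma> where "\<sigma> = Re ((x - c) * cnj e)"
    define h where "h = x - c - of_real \<sigma> * e"
    have "Re (h * cnj e) = \<sigma> - Re (of_real \<sigma> * (e * cnj e))"
      unfolding h_def left_diff_distrib minus_complex.sel mult.assoc \<sigma>_def ..
    then have he: "Re (h * cnj e) = 0" unfolding ee by simp
    have sq: "(cmod (h + of_real \<tau> * e))\<^sup>2 = (cmod h)\<^sup>2 + \<tau>\<^sup>2" for \<tau>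
    proof -
      have "Re (h * cnj (of_real \<tau> * e)) = \<tau> * Re (h * cnj e)"
        by (simp add: algebra_simps)
      then show ?thesis unfolding cmod_add_sq he by (simp add: norm_mult e)
    qed
    have xh: "x - c = h + of_real \<sigma> * e" by (simp add: h_def)
    have yh: "y - c = h + of_real (\<sigma> + D) * e" and zh: "z - c = h + of_real (\<sigma> + b * D) * e"
    proof -
      have De: "of_real D * e = y - x" using D by (simp add: e_def)
      then show "y - c = h + of_real (\<sigma> + D) * e" by (simp add: h_def algebra_simps)
      have a: "a = 1 - b" using ab by simp
      have "z = x + of_real b * (y - x)"
        unfolding z_def a by (simp add: scaleR_conv_of_real algebra_simps)
      then show "z - c = h + of_real (\<sigma> + b * D) * e"
        unfolding De[symmetric] by (simp add: h_def algebra_simps)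
    qed
    define L where "L = sqrt (r\<^sup>2 - (cmod h)\<^sup>2)"
    have lt: "(cmod h)\<^sup>2 + \<tau>\<^sup>2 < r\<^sup>2" if "cmod (h + of_real \<tau> * e) < r" for \<tau>
      unfolding sq[symmetric] using that by (intro power_strict_mono) auto
    have "(cmod h)\<^sup>2 + \<sigma>\<^sup>2 < r\<^sup>2"
      by (rule lt) (use x in \<open>simp flip: xh\<close>)
    then have "(cmod h)\<^sup>2 < r\<^sup>2" using zero_le_power2[of \<sigma>] by linarith
    then have L: "L > 0" "L\<^sup>2 = r\<^sup>2 - (cmod h)\<^sup>2" by (simp_all add: L_def)
    have small: "- L < \<tau> \<and> \<tau> < L" if "cmod (h + of_real \<tau> * e) < r" for \<tau>
    proof -
      have "\<tau>\<^sup>2 < L\<^sup>2" using lt[OF that] L by simp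
      then have "\<bar>\<tau>\<bar> < L" using L(1) by (intro power2_less_imp_less[of "\<bar>\<tau>\<bar>"]) simp_all
      then show ?thesis by auto
    qed
    \<comment> \<open>The ends of the chord, which are the ideal endpoints of the geodesic over the
      line; position \<tau> has semicircle parameter (\<tau> + L) / (2 L).\<close>
    define u v where "u = c + h - of_real L * e" and "v = c + h + of_real L * e"
    have vu: "v - u = of_real (2 * L) * e" by (simp add: u_def v_def algebra_simps)
    have uv: "u \<noteq> v"
    proof
      assume "u = v"
      then have "of_real (2 * L) * e = 0" using vu by simp
      then show False using L e by auto
    qed
    have semicircle: "semicircle u v ((\<tau> + L) / (2 * L)) = Some (x', sqrt (r\<^sup>2 - (cmod (x' - c))\<^sup>2))"
      if x': "x' - c = h + of_real \<tau> * e" for \<tau> x'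
    proof -
      have "of_real ((\<tau> + L) / (2 * L)) * (v - u) = of_real (\<tau> + L) * e"
        unfolding vu using L by simp
      then have "u + of_real ((\<tau> + L) / (2 * L)) * (v - u) = c + (h + of_real \<tau> * e)"
        by (simp add: u_def algebra_simps)
      also have "\<dots> = x'" unfolding x'[symmetric] by simp
      finally have 1: "u + of_real ((\<tau> + L) / (2 * L)) * (v - u) = x'" .
      have "cmod (v - u) = sqrt ((2 * L)\<^sup>2)" unfolding vu
      by (subst real_sqrt_abs) (use L(1) e in \<open>simp add: norm_mult\<close>)
      then have "cmod (v - u) * sqrt ((\<tau> + L) / (2 * L) * (1 - (\<tau> + L) / (2 * L))) =
          sqrt ((2 * L)\<^sup>2 * ((\<tau> + L) / (2 * L) * (1 - (\<tau> + L) / (2 * L))))"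
        by (simp only: real_sqrt_mult)
      also have "(2 * L)\<^sup>2 * ((\<tau> + L) / (2 * L) * (1 - (\<tau> + L) / (2 * L))) = L\<^sup>2 - \<tau>\<^sup>2"
        using L(1) by (simp add: field_simps power2_eq_square)
      also have "\<dots> = r\<^sup>2 - (cmod (x' - c))\<^sup>2" unfolding x' sq L(2) by simp
      finally show ?thesis unfolding semicircle_def 1 by simp
    qed
    have "geod_between (semicircle u v ((\<sigma> + L) / (2 * L))) (semicircle u v ((\<sigma> + b * D + L) / (2 * L)))
      (semicircle u v ((\<sigma> + D + L) / (2 * L)))"
    proof (rule geod_arc[OF uv])
      have "- L < \<sigma>" "\<sigma> + D < L" using small[of \<sigma>, folded xh] small[of "\<sigma> + D", folded yh] x y by auto
      moreover have "0 \<le> b * D" "b * D \<le> D" using ab D by (auto simp: mult_le_cancel_right1)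
      ultimately show "0 \<le> (\<sigma> + L) / (2 * L)" "(\<sigma> + L) / (2 * L) \<le> (\<sigma> + b * D + L) / (2 * L)"
        "(\<sigma> + b * D + L) / (2 * L) \<le> (\<sigma> + D + L) / (2 * L)" "(\<sigma> + D + L) / (2 * L) < 1"
        using L(1) by (auto intro!: divide_right_mono simp: divide_less_eq)
    qed
    then have "geod_between (Some (x, sqrt (r\<^sup>2 - (cmod (x - c))\<^sup>2)))
      (Some (z, sqrt (r\<^sup>2 - (cmod (z - c))\<^sup>2))) (Some (y, sqrt (r\<^sup>2 - (cmod (y - c))\<^sup>2)))"
      unfolding semicircle[OF xh] semicircle[OF yh] semicircle[OF zh] .
    then have "Some (z, sqrt (r\<^sup>2 - (cmod (z - c))\<^sup>2)) \<in> C"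
      using x y by (auto intro: geod_convexD[OF C])
    then show ?thesis using zr unfolding z_def by simp
  qed
qed

section \<open>Hulls of the six vertices with one or two cusps\<close>

lemma hyp_hull_iff:
  "x \<in> hyp_hull A \<longleftrightarrow> x \<in> H3 \<and> (\<forall>C. geod_convex C \<longrightarrow> A \<subseteq> C \<longrightarrow> Some x \<in> C)"
  by (auto simp: hyp_hull_def hull_def)

text \<open>A half-space that contains A contains its hull. The sign of the leading coefficient puts
  infinity into the half-space, so only finite points of A have to be tested.\<close>

lemma hyp_hull_inequality:
  assumes A: "\<And>z t. Some (z, t) \<in> A \<Longrightarrow>
      0 \<le> \<alpha> * ((cmod (of_real q * z - l))\<^sup>2 + (q * t)\<^sup>2) + 2 * Re (cnj \<beta> * (of_real q * z - l)) + \<kappa>"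
    and "\<alpha> \<ge> 0" and x: "(z, t) \<in> hyp_hull A"
  shows "0 \<le> \<alpha> * ((cmod (of_real q * z - l))\<^sup>2 + (q * t)\<^sup>2) + 2 * Re (cnj \<beta> * (of_real q * z - l)) + \<kappa>"
proof -
  \<comment> \<open>The coefficients come from expanding the inequality, stated for q z - l, in the
    unscaled coordinate z.\<close>
  define S where "S = halfspace (\<alpha> * q\<^sup>2) (of_real q * (\<beta> - of_real \<alpha> * l))
    (\<kappa> + \<alpha> * (cmod l)\<^sup>2 - 2 * Re (cnj \<beta> * l))"
  have iff: "Some (z, t) \<in> S \<longleftrightarrow>
    0 \<le> \<alpha> * ((cmod (of_real q * z - l))\<^sup>2 + (q * t)\<^sup>2) + 2 * Re (cnj \<beta> * (of_real q * z - l)) + \<kappa>" for z t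
    unfolding S_def halfspace_simps cmod_diff_sq
    by (simp add: norm_mult power_mult_distrib algebra_simps)
  have "P \<in> S" if "P \<in> A" for P
  proof (cases P)
    case None
    then show ?thesis using \<open>\<alpha> \<ge> 0\<close> by (simp add: S_def)
  next
    case (Some y)
    then show ?thesis using iff A that by (cases y) auto
  qed
  then have "A \<subseteq> S" ..
  moreover have "geod_convex S" unfolding S_def by (rule geod_convex_halfspace)
  ultimately have "Some (z, t) \<in> S" using x[unfolded hyp_hull_iff] by simp
  then show ?thesis using iff by blast
qed

text \<open>2/11 = 1 - 9/11: after scaling by q the six vertices lie on the unit hemisphere around
  l, so they span a face in a single geodesic plane.\<close>

locale hexagon_hull =
  fixes q h :: real and l :: complex
  assumes q: "q > 0" and h: "h > 0" "(q * h)\<^sup>2 = 2 / 11"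
begin

definition points :: "ext_point set" where
  "points = (\<lambda>v. Some ((v + l) / of_real q, h)) ` hex_vertices"

lemma points_scaled:
  assumes "Some (z, t) \<in> points"
  shows "of_real q * z - l \<in> hex 1" "(cmod (of_real q * z - l))\<^sup>2 + (q * t)\<^sup>2 = 1"
proof -
  obtain v where v: "v \<in> hex_vertices" "z = (v + l) / of_real q" "t = h"
    using assms by (auto simp: points_def)
  have z: "of_real q * z - l = v" unfolding v(2) using q by simp
  show "of_real q * z - l \<in> hex 1" "(cmod (of_real q * z - l))\<^sup>2 + (q * t)\<^sup>2 = 1"
    unfolding z v(3) h(2) hex_vertices_props(2)[OF v(1)] using hex_vertices_props(1)[OF v(1)] by simp_all
qed

text \<open>The part of the hemisphere lying in C projects to a convex set by
  \<open>convex_hemisphere_projection\<close>; containing the six vertices, it contains the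
  hexagon.\<close>

lemma floor_mem:
  assumes C: "geod_convex C" "points \<subseteq> C" and z: "of_real q * z - l \<in> hex 1"
  shows "Some (z, sqrt ((1 / q)\<^sup>2 - (cmod (z - l / of_real q))\<^sup>2)) \<in> C"
proof -
  define S where "S = {z. cmod (z - l / of_real q) < 1 / q \<and>
    Some (z, sqrt ((1 / q)\<^sup>2 - (cmod (z - l / of_real q))\<^sup>2)) \<in> C}"
  have "convex S" unfolding S_def by (rule convex_hemisphere_projection[OF C(1)])
  then have K: "convex ((\<lambda>x. - l + q *\<^sub>R x) ` S)" by (rule convex_affinity)
  have "hex_vertices \<subseteq> (\<lambda>x. - l + q *\<^sub>R x) ` S"
  proof
    fix v assume v: "v \<in> hex_vertices"
    define x where "x = (v + l) / of_real q"
    have xl: "x - l / of_real q = v / of_real q" by (simp add: x_def add_divide_distrib)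
    have sq: "(cmod (x - l / of_real q))\<^sup>2 = 9 / 11 / q\<^sup>2"
      unfolding xl norm_divide power_divide hex_vertices_props(2)[OF v] by simp
    have "(cmod (x - l / of_real q))\<^sup>2 < (1 / q)\<^sup>2"
    proof -
      have "9 / 11 / q\<^sup>2 < 1 / q\<^sup>2" using q by (intro divide_strict_right_mono) auto
      then show ?thesis unfolding sq by (simp add: power_divide)
    qed
    then have "cmod (x - l / of_real q) < 1 / q" by (rule power2_less_imp_less) (use q in simp)
    moreover have "sqrt ((1 / q)\<^sup>2 - (cmod (x - l / of_real q))\<^sup>2) = h"
    proof (rule real_sqrt_unique)
      have "h\<^sup>2 = (q * h)\<^sup>2 / q\<^sup>2" unfolding power_mult_distrib using q by simp
      also have "\<dots> = (1 / q)\<^sup>2 - 9 / 11 / q\<^sup>2" unfolding h(2) by (simp add: power_divide)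
      finally show "h\<^sup>2 = (1 / q)\<^sup>2 - (cmod (x - l / of_real q))\<^sup>2" unfolding sq .
    qed (use h(1) in simp)
    moreover have "Some (x, h) \<in> C" by (rule subsetD[OF C(2)]) (use v in \<open>unfold points_def x_def, rule imageI\<close>)
    ultimately have "x \<in> S" by (simp add: S_def)
    moreover have "v = - l + q *\<^sub>R x" using q by (simp add: x_def scaleR_conv_of_real)
    ultimately show "v \<in> (\<lambda>x. - l + q *\<^sub>R x) ` S" by (intro image_eqI)
  qed
  from subsetD[OF hex_subset_convex[OF K this] z]
  obtain x where x: "of_real q * z - l = - l + q *\<^sub>R x" "x \<in> S" by (rule imageE)
  then have "z = x" using q by (simp add: scaleR_conv_of_real)
  then show ?thesis using x(2) by (simp add: S_def)
qed

definition prism :: "(complex \<times> real) set" where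
  "prism = {(z, t). t > 0 \<and> of_real q * z - l \<in> hex 1 \<and> 1 \<le> (cmod (of_real q * z - l))\<^sup>2 + (q * t)\<^sup>2}"

lemma scaled_cmod: "(cmod (z - l / of_real q))\<^sup>2 = (cmod (of_real q * z - l))\<^sup>2 / q\<^sup>2"
proof -
  have "z - l / of_real q = (of_real q * z - l) / of_real q" using q by (simp add: field_simps)
  then show ?thesis using q by (simp add: norm_divide power_divide)
qed

lemma prism_mem:
  assumes C: "geod_convex C" "points \<subseteq> C" "None \<in> C" and x: "(z, t) \<in> prism"
  shows "Some (z, t) \<in> C"
proof -
  have zt: "t > 0" "of_real q * z - l \<in> hex 1" "1 \<le> (cmod (of_real q * z - l))\<^sup>2 + (q * t)\<^sup>2"
    using x by (auto simp: prism_def)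
  define t0 where "t0 = sqrt ((1 / q)\<^sup>2 - (cmod (z - l / of_real q))\<^sup>2)"
  have t0: "(1 / q)\<^sup>2 - (cmod (z - l / of_real q))\<^sup>2 = (1 - (cmod (of_real q * z - l))\<^sup>2) / q\<^sup>2"
    unfolding scaled_cmod by (simp add: power_divide diff_divide_distrib)
  have "0 \<le> t0" unfolding t0_def t0 using hex_cmod[OF zt(2)] by simp
  moreover have "t0 \<le> t"
    unfolding t0_def t0
  proof (rule real_le_lsqrt)
    show "(1 - (cmod (of_real q * z - l))\<^sup>2) / q\<^sup>2 \<le> t\<^sup>2"
      using zt(3) q by (simp add: divide_le_eq power_mult_distrib algebra_simps)
  qed (use zt in simp_all)
  moreover have "Some (z, t0) \<in> C" unfolding t0_def by (rule floor_mem[OF C(1,2) zt(2)])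
  ultimately show ?thesis
    using geod_convexD[OF C(1) _ C(3)] geod_vertical_infinity[of t0 t z] by simp
qed

lemma hyp_hull_prism: "hyp_hull ({None} \<union> points) = prism"
proof (intro equalityI subsetI)
  fix x assume x: "x \<in> hyp_hull ({None} \<union> points)"
  obtain z t where zt: "x = (z, t)" by (cases x)
  have "0 \<le> (cmod \<beta>)\<^sup>2 * 1 + 2 * Re (cnj \<beta> * (of_real q * z - l))"
    if "\<beta> \<in> {1, - 1, \<omega>, - \<omega>, \<omega> + 1, - (\<omega> + 1)}" for \<beta>
  proof -
    have "0 \<le> 0 * ((cmod (of_real q * z - l))\<^sup>2 + (q * t)\<^sup>2) +
        2 * Re (cnj \<beta> * (of_real q * z - l)) + (cmod \<beta>)\<^sup>2"
    proof (rule hyp_hull_inequality[OF _ _ x[unfolded zt]])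
      fix y s assume "Some (y, s) \<in> {None} \<union> points"
      then have "of_real q * y - l \<in> hex 1" using points_scaled(1) by simp
      then have "0 \<le> (cmod \<beta>)\<^sup>2 * 1 + 2 * Re (cnj \<beta> * (of_real q * y - l))"
        using that unfolding hex_halfspaces by blast
      then show "0 \<le> 0 * ((cmod (of_real q * y - l))\<^sup>2 + (q * s)\<^sup>2) +
          2 * Re (cnj \<beta> * (of_real q * y - l)) + (cmod \<beta>)\<^sup>2"
        by linarith
    qed simp
    then show ?thesis by linarith
  qed
  then have "of_real q * z - l \<in> hex 1" unfolding hex_halfspaces by blast
  moreover have "0 \<le> 1 * ((cmod (of_real q * z - l))\<^sup>2 + (q * t)\<^sup>2) +
      2 * Re (cnj 0 * (of_real q * z - l)) + - 1"
    by (rule hyp_hull_inequality[OF _ _ x[unfolded zt]]) (auto simp: points_scaled(2))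
  moreover have "t > 0" using x unfolding hyp_hull_iff H3_def zt by simp
  ultimately show "x \<in> prism" unfolding zt prism_def by simp
next
  fix x assume "x \<in> prism"
  then show "x \<in> hyp_hull ({None} \<union> points)"
    unfolding hyp_hull_iff using prism_mem by (cases x) (auto simp: prism_def H3_def)
qed

end

text \<open>Thales: the last equation, with x = \<theta> v, describes the semicircle on the diameter
  from 0 to v, and spares its users the square root for the height.\<close>

lemma arc_origin:
  assumes "x = of_real \<theta> * v" "y \<ge> 0" "(cmod x)\<^sup>2 + y\<^sup>2 = \<theta> * (cmod v)\<^sup>2"
  shows "semicircle 0 v \<theta> = Some (x, y)"
proof -
  have "cmod v * sqrt (\<theta> * (1 - \<theta>)) = sqrt ((cmod v)\<^sup>2 * (\<theta> * (1 - \<theta>)))"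
    by (simp add: real_sqrt_mult)
  also have "\<dots> = y"
  proof (rule real_sqrt_unique)
    show "y\<^sup>2 = (cmod v)\<^sup>2 * (\<theta> * (1 - \<theta>))"
      using assms(3) unfolding assms(1)
      by (simp add: norm_mult power_mult_distrib) (simp add: power2_eq_square algebra_simps)
  qed fact
  finally show ?thesis using assms(1) by (simp add: semicircle_def)
qed

locale cusp_hull = hexagon_hull q h 0 for q h
begin

text \<open>The second hexagon condition is the exterior of the six spheres through the cusp: the
  point inverted in the unit hemisphere also lies over the hexagon.\<close>

definition core :: "(complex \<times> real) set" where
  "core = {(z, t). t > 0 \<and> of_real q * z \<in> hex 1 \<and>
     of_real q * z \<in> hex ((cmod (of_real q * z))\<^sup>2 + (q * t)\<^sup>2)}"

text \<open>Below the unit hemisphere, a point lies between the cusp \<open>0\<close> and a point of the hemisphere.\<close>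

lemma core_mem:
  assumes C: "geod_convex C" "points \<subseteq> C" "None \<in> C" "Some (0, 0) \<in> C" and x: "(z, t) \<in> core"
  shows "Some (z, t) \<in> C"
proof -
  define w s where "w = of_real q * z" and "s = (cmod w)\<^sup>2 + (q * t)\<^sup>2"
  have zt: "t > 0" "w \<in> hex 1" "w \<in> hex s" using x by (auto simp: core_def w_def s_def)
  show ?thesis
  proof (cases "1 \<le> s")
    case True
    then show ?thesis using prism_mem[OF C(1-3)] zt unfolding prism_def w_def s_def by simp
  next
    case False
    have s0: "s > 0" using zt q unfolding s_def by (simp add: add_nonneg_pos)
    \<comment> \<open>Inversion in the unit hemisphere turns the geodesic from the cusp through the
      given point into the vertical line over w / s. The hemisphere is fixed pointwise, so the
      geodesic meets it above y, and \<open>floor_mem\<close> applies there.\<close>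
    define y where "y = z / of_real s"
    define t' where "t' = sqrt ((1 / q)\<^sup>2 - (cmod (y - 0 / of_real q))\<^sup>2)"
    have qy: "of_real q * y = w / of_real s" by (simp add: y_def w_def)
    then have yh: "of_real q * y - 0 \<in> hex 1" using zt(3) hex_divide[OF s0] by simp
    then have yC: "Some (y, t') \<in> C" unfolding t'_def by (rule floor_mem[OF C(1,2)])
    have y9: "(cmod (of_real q * y))\<^sup>2 \<le> 9 / 11" using hex_cmod[OF yh] by simp
    have "(cmod y)\<^sup>2 * q\<^sup>2 \<le> 9 / 11" using y9 by (simp add: norm_mult power_mult_distrib mult.commute)
    then have ylt: "(cmod y)\<^sup>2 < (1 / q)\<^sup>2" using q by (simp add: power_divide less_divide_eq)
    then have t': "t' \<ge> 0" "(cmod y)\<^sup>2 + t'\<^sup>2 = (1 / q)\<^sup>2" by (simp_all add: t'_def)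
    have zq: "(cmod z)\<^sup>2 + t\<^sup>2 = s / q\<^sup>2"
      using q by (simp add: s_def w_def norm_mult power_mult_distrib add_divide_distrib)
    show ?thesis
    proof (cases "z = 0")
      case True
      then have y0: "y = 0" by (simp add: y_def)
      have "t\<^sup>2 \<le> t'\<^sup>2"
        using zq t'(2) False True y0 q by (simp add: power_divide divide_right_mono)
      then have "t \<le> t'" using t'(1) by (rule power2_le_imp_le)
      then show ?thesis
        using geod_convexD[OF C(1,4) yC] geod_vertical[of 0 t t' 0] zt(1) unfolding y0 True by simp
    next
      case z0: False
      then have w0: "cmod w > 0" "cmod z > 0" using q by (simp_all add: w_def)
      \<comment> \<open>The other ideal endpoint of this geodesic: the inverse of the foot w / s,
        scaled back by q.\<close>
      define v where "v = z * of_real (s / (cmod w)\<^sup>2)"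
      have wz: "(cmod w)\<^sup>2 = q\<^sup>2 * (cmod z)\<^sup>2" by (simp add: w_def norm_mult power_mult_distrib)
      have v2: "(cmod v)\<^sup>2 = s\<^sup>2 / (q\<^sup>2 * (cmod w)\<^sup>2)"
      proof -
        have W: "W / Q * (s / W)\<^sup>2 = s\<^sup>2 / (Q * W)" if "W > 0" for W Q :: real
          using that by (simp add: power2_eq_square)
        have "cmod v = cmod z * (s / (cmod w)\<^sup>2)"
          unfolding v_def norm_mult norm_of_real using s0 by simp
        then have "(cmod v)\<^sup>2 = (cmod z)\<^sup>2 * (s / (cmod w)\<^sup>2)\<^sup>2" by (simp only: power_mult_distrib)
        also have "(cmod z)\<^sup>2 = (cmod w)\<^sup>2 / q\<^sup>2" unfolding wz using q by simp
        finally show ?thesis using W[of "(cmod w)\<^sup>2" "q\<^sup>2"] w0 by simp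
      qed
      have P: "semicircle 0 v ((cmod w)\<^sup>2 / s) = Some (z, t)"
      proof (rule arc_origin)
        show "z = of_real ((cmod w)\<^sup>2 / s) * v" using w0 s0 by (simp add: v_def)
        show "(cmod z)\<^sup>2 + t\<^sup>2 = (cmod w)\<^sup>2 / s * (cmod v)\<^sup>2"
          unfolding zq v2 using w0 s0 q by (simp add: power2_eq_square)
      qed (use zt in simp)
      have Q: "semicircle 0 v ((cmod w)\<^sup>2 / s\<^sup>2) = Some (y, t')"
      proof (rule arc_origin)
        show "y = of_real ((cmod w)\<^sup>2 / s\<^sup>2) * v"
          using w0 s0 by (simp add: v_def y_def power2_eq_square)
        show "(cmod y)\<^sup>2 + t'\<^sup>2 = (cmod w)\<^sup>2 / s\<^sup>2 * (cmod v)\<^sup>2"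
          unfolding t'(2) v2 using w0 s0 q by (simp add: power_divide)
      qed (use t' in simp)
      have O: "semicircle 0 v 0 = Some (0, 0)" by (simp add: semicircle_def)
      have "geod_between (semicircle 0 v 0) (semicircle 0 v ((cmod w)\<^sup>2 / s)) (semicircle 0 v ((cmod w)\<^sup>2 / s\<^sup>2))"
      proof (rule geod_arc)
        show "0 \<noteq> v" using w0 s0 by (auto simp: v_def)
        show "0 \<le> (cmod w)\<^sup>2 / s" using s0 by simp
        have "s\<^sup>2 \<le> s" using s0 False by (simp add: power2_eq_square mult_le_cancel_right1)
        then show "(cmod w)\<^sup>2 / s \<le> (cmod w)\<^sup>2 / s\<^sup>2" using s0 by (intro divide_left_mono) auto
        have "(cmod w)\<^sup>2 / s\<^sup>2 = (cmod (of_real q * y))\<^sup>2"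
          unfolding qy using s0 by (simp add: norm_divide power_divide)
        then show "(cmod w)\<^sup>2 / s\<^sup>2 < 1" using y9 by linarith
      qed simp
      then show ?thesis unfolding P Q O by (rule geod_convexD[OF C(1,4) yC])
    qed
  qed
qed

text \<open>At the six points s = 1, so each wall inequality coincides with its inverted form; at
  the cusp 0 the inverted form is an equality. Hence all twelve half-spaces contain the generating
  points.\<close>

lemma hyp_hull_core: "hyp_hull ({Some (0, 0), None} \<union> points) = core"
proof (intro equalityI subsetI)
  fix x assume x: "x \<in> hyp_hull ({Some (0, 0), None} \<union> points)"
  obtain z t where zt: "x = (z, t)" by (cases x)
  have "0 \<le> (cmod \<beta>)\<^sup>2 * 1 + 2 * Re (cnj \<beta> * (of_real q * z)) \<and>
      0 \<le> (cmod \<beta>)\<^sup>2 * ((cmod (of_real q * z))\<^sup>2 + (q * t)\<^sup>2) + 2 * Re (cnj \<beta> * (of_real q * z))"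
    if b: "\<beta> \<in> {1, - 1, \<omega>, - \<omega>, \<omega> + 1, - (\<omega> + 1)}" for \<beta>
  proof
    have pt: "0 \<le> (cmod \<beta>)\<^sup>2 * 1 + 2 * Re (cnj \<beta> * (of_real q * y - 0))"
      "(cmod (of_real q * y - 0))\<^sup>2 + (q * s)\<^sup>2 = 1"
      if "Some (y, s) \<in> points" for y s
      using points_scaled[OF that] b unfolding hex_halfspaces by blast+
    have "0 \<le> 0 * ((cmod (of_real q * z - 0))\<^sup>2 + (q * t)\<^sup>2) +
        2 * Re (cnj \<beta> * (of_real q * z - 0)) + (cmod \<beta>)\<^sup>2"
    proof (rule hyp_hull_inequality[OF _ _ x[unfolded zt]])
      fix y s assume "Some (y, s) \<in> {Some (0, 0), None} \<union> points"
      then consider "y = 0" "s = 0" | "Some (y, s) \<in> points" by auto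
      then show "0 \<le> 0 * ((cmod (of_real q * y - 0))\<^sup>2 + (q * s)\<^sup>2) +
          2 * Re (cnj \<beta> * (of_real q * y - 0)) + (cmod \<beta>)\<^sup>2"
      proof cases
        case 2
        then show ?thesis using pt(1) by (simp add: add.commute)
      qed simp
    qed simp
    then show "0 \<le> (cmod \<beta>)\<^sup>2 * 1 + 2 * Re (cnj \<beta> * (of_real q * z))" by simp
    have "0 \<le> (cmod \<beta>)\<^sup>2 * ((cmod (of_real q * z - 0))\<^sup>2 + (q * t)\<^sup>2) +
        2 * Re (cnj \<beta> * (of_real q * z - 0)) + 0"
    proof (rule hyp_hull_inequality[OF _ _ x[unfolded zt]])
      fix y s assume "Some (y, s) \<in> {Some (0, 0), None} \<union> points"
      then consider "y = 0" "s = 0" | "Some (y, s) \<in> points" by auto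
      then show "0 \<le> (cmod \<beta>)\<^sup>2 * ((cmod (of_real q * y - 0))\<^sup>2 + (q * s)\<^sup>2) +
          2 * Re (cnj \<beta> * (of_real q * y - 0)) + 0"
      proof cases
        case 2
        then show ?thesis unfolding pt(2)[OF 2] using pt(1) by simp
      qed simp
    qed simp
    then show "0 \<le> (cmod \<beta>)\<^sup>2 * ((cmod (of_real q * z))\<^sup>2 + (q * t)\<^sup>2) + 2 * Re (cnj \<beta> * (of_real q * z))"
      by simp
  qed
  then have "of_real q * z \<in> hex 1" "of_real q * z \<in> hex ((cmod (of_real q * z))\<^sup>2 + (q * t)\<^sup>2)"
    unfolding hex_halfspaces by blast+
  moreover have "t > 0" using x unfolding hyp_hull_iff H3_def zt by simp
  ultimately show "x \<in> core" unfolding zt core_def by simp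
next
  fix x assume "x \<in> core"
  then show "x \<in> hyp_hull ({Some (0, 0), None} \<union> points)"
    unfolding hyp_hull_iff using core_mem by (cases x) (auto simp: core_def H3_def)
qed

end

section \<open>The fundamental domain of the translations\<close>

lemma closed_hex: "closed (hex 1)"
proof -
  have "hex 1 = {z. 2 * \<bar>Re z\<bar> \<le> 1} \<inter> {z. \<bar>Re z\<bar> + sqrt 11 * \<bar>Im z\<bar> \<le> 3}"
    by (auto simp: hex_def)
  then show ?thesis by (simp only:) (intro closed_Int closed_Collect_le continuous_intros)
qed

lemma convex_hex: "convex (hex 1)"
proof (rule convexI)
  fix x y :: complex and a b :: real
  assume x: "x \<in> hex 1" and y: "y \<in> hex 1" and ab: "0 \<le> a" "0 \<le> b" "a + b = 1"
  show "a *\<^sub>R x + b *\<^sub>R y \<in> hex 1"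
    unfolding hex_halfspaces
  proof
    fix \<beta> assume \<beta>: "\<beta> \<in> {1, - 1, \<omega>, - \<omega>, \<omega> + 1, - (\<omega> + 1)}"
    have P: "0 \<le> (cmod \<beta>)\<^sup>2 * 1 + 2 * Re (cnj \<beta> * v)" if "v \<in> hex 1" for v
      using that \<beta> unfolding hex_halfspaces by blast
    have "0 \<le> a * ((cmod \<beta>)\<^sup>2 * 1 + 2 * Re (cnj \<beta> * x)) + b * ((cmod \<beta>)\<^sup>2 * 1 + 2 * Re (cnj \<beta> * y))"
      by (rule add_nonneg_nonneg[OF mult_nonneg_nonneg[OF ab(1) P[OF x]] mult_nonneg_nonneg[OF ab(2) P[OF y]]])
    also have "\<dots> = (a + b) * (cmod \<beta>)\<^sup>2 + 2 * (a * Re (cnj \<beta> * x) + b * Re (cnj \<beta> * y))"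
      by (simp only: distrib_left distrib_right mult_1_right mult.assoc mult.left_commute[of _ 2] add_ac)
    also have "a * Re (cnj \<beta> * x) + b * Re (cnj \<beta> * y) = Re (cnj \<beta> * (a *\<^sub>R x + b *\<^sub>R y))"
      by (simp add: algebra_simps)
    finally show "0 \<le> (cmod \<beta>)\<^sup>2 * 1 + 2 * Re (cnj \<beta> * (a *\<^sub>R x + b *\<^sub>R y))" using ab(3) by simp
  qed
qed

text \<open>The case \<gamma> = 1 of \<open>hex_reduced\<close>: no lattice point -d is closer to z
  than 0 is.\<close>

lemma hex_voronoi:
  assumes "z \<in> hex 1" "d \<in> carrier O11"
  shows "0 \<le> (cmod d)\<^sup>2 + 2 * Re (z * cnj d)"
proof -
  have "1 \<in> carrier O11" using O11_int[of 1] by simp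
  from hex_reduced[OF assms(1) this _ assms(2)] show ?thesis by simp
qed

definition cell :: "real \<Rightarrow> complex \<Rightarrow> (complex \<times> real) set" where
  "cell q l = {(z, t). t > 0 \<and> of_real q * z - l \<in> hex 1}"

lemma convex_cell: "convex (cell q l)"
proof (rule convexI)
  fix x y :: "complex \<times> real" and a b :: real
  assume x: "x \<in> cell q l" and y: "y \<in> cell q l" and ab: "0 \<le> a" "0 \<le> b" "a + b = 1"
  obtain z t w s where xy: "x = (z, t)" "y = (w, s)" by (cases x, cases y)
  have "a *\<^sub>R t + b *\<^sub>R s \<in> {0<..}"
    using x y ab unfolding xy cell_def by (intro convexD[of "{0<..}"]) auto
  moreover have "a *\<^sub>R (of_real q * z - l) + b *\<^sub>R (of_real q * w - l) \<in> hex 1"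
    using x y ab unfolding xy cell_def by (intro convexD[OF convex_hex]) auto
  moreover have "a *\<^sub>R (of_real q * z - l) + b *\<^sub>R (of_real q * w - l) =
      of_real q * (a *\<^sub>R z + b *\<^sub>R w) - (a + b) *\<^sub>R l"
    by (simp add: scaleR_conv_of_real algebra_simps)
  ultimately show "a *\<^sub>R x + b *\<^sub>R y \<in> cell q l"
    unfolding xy cell_def ab(3) by simp
qed

lemma closedin_cell: "closedin (top_of_set H3) (cell q l)"
proof -
  have "closed ((\<lambda>x :: complex \<times> real. of_real q * fst x - l) -` hex 1)"
    by (intro continuous_closed_vimage closed_hex continuous_intros)
  moreover have "cell q l = H3 \<inter> (\<lambda>x. of_real q * fst x - l) -` hex 1"
    by (auto simp: cell_def H3_def)
  ultimately show ?thesis unfolding closedin_closed by blast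
qed

lemma interior_cell_nonempty:
  assumes q: "q > 0"
  shows "interior (cell q l) \<noteq> {}"
proof -
  \<comment> \<open>Radius 1/4 is small enough: since \<open>sqrt 11 \<le> 4\<close>, the second
    form of \<open>hex\<close> stays below 5/4.\<close>
  define U where "U = {x :: complex \<times> real. cmod (of_real q * fst x - l) < 1 / 4} \<inter> {x. 0 < snd x}"
  have "open U" unfolding U_def by (intro open_Int open_Collect_less continuous_intros)
  moreover have "U \<subseteq> cell q l"
  proof
    fix x assume x: "x \<in> U"
    define w where "w = of_real q * fst x - l"
    have w: "cmod w < 1 / 4" using x by (simp add: U_def w_def)
    then have ri: "\<bar>Re w\<bar> < 1 / 4" "\<bar>Im w\<bar> < 1 / 4"
      using abs_Re_le_cmod[of w] abs_Im_le_cmod[of w] by linarith+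
    have "sqrt 11 \<le> 4" by (rule real_le_lsqrt) auto
    then have "sqrt 11 * \<bar>Im w\<bar> \<le> 4 * (1 / 4)" using ri by (intro mult_mono) auto
    then have "w \<in> hex 1" using ri unfolding hex_def by auto
    then show "x \<in> cell q l" using x by (auto simp: cell_def U_def w_def split_beta)
  qed
  moreover have "(l / of_real q, 1) \<in> U" using q by (simp add: U_def)
  ultimately show ?thesis using interior_maximal by blast
qed

text \<open>Allows an open set that meets a cell, possibly only at its boundary, to be shrunk to an
  open set inside that cell.\<close>

lemma cell_closure:
  assumes "q > 0"
  shows "cell q l \<subseteq> closure (interior (cell q l))"
  using convex_closure_interior[OF convex_cell interior_cell_nonempty[OF assms]] closure_subset by blast

text \<open>Points common to both cells lie on the bisector of l and m, so f is constant where they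
  overlap. A step in the direction \<delta> = m - l stays inside the open set but increases
  f.\<close>

lemma cells_overlap:
  assumes q: "q > 0" and lm: "l \<in> carrier O11" "m \<in> carrier O11"
    and U: "open U" "U \<noteq> {}" "U \<subseteq> cell q l" "U \<subseteq> cell q m"
  shows "l = m"
proof (rule ccontr)
  assume "l \<noteq> m"
  define \<delta> where "\<delta> = m - l"
  have d: "\<delta> \<noteq> 0" "\<delta> \<in> carrier O11" "- \<delta> \<in> carrier O11"
    using \<open>l \<noteq> m\<close> O11_diff[OF lm(2,1)] O11_diff[OF lm] by (auto simp: \<delta>_def)
  obtain z t where zt: "(z, t) \<in> U" using U(2) by (metis equals0I surj_pair)
  obtain e where e: "e > 0" "ball (z, t) e \<subseteq> U" using U(1) zt openE by blast
  define f where "f h = 2 * Re ((of_real q * (z + h) - l) * cnj \<delta>)" for h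
  have f: "f h = (cmod \<delta>)\<^sup>2" if "cmod h < e" for h
  proof -
    have "(z + h, t) \<in> ball (z, t) e" using that by (simp add: dist_Pair_Pair dist_norm)
    then have "(z + h, t) \<in> cell q l" "(z + h, t) \<in> cell q m" using e U by blast+
    then have h: "of_real q * (z + h) - l \<in> hex 1" "of_real q * (z + h) - m \<in> hex 1"
      by (simp_all add: cell_def)
    have "0 \<le> (cmod (- \<delta>))\<^sup>2 + 2 * Re ((of_real q * (z + h) - l) * cnj (- \<delta>))"
      by (rule hex_voronoi[OF h(1) d(3)])
    then have "f h \<le> (cmod \<delta>)\<^sup>2"
      unfolding f_def norm_minus_cancel complex_cnj_minus mult_minus_right uminus_complex.sel by linarith
    moreover have "0 \<le> (cmod \<delta>)\<^sup>2 + 2 * Re ((of_real q * (z + h) - m) * cnj \<delta>)"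
      by (rule hex_voronoi[OF h(2) d(2)])
    moreover have "(of_real q * (z + h) - m) * cnj \<delta> =
        (of_real q * (z + h) - l) * cnj \<delta> - of_real ((cmod \<delta>)\<^sup>2)"
      unfolding complex_norm_square by (simp add: \<delta>_def algebra_simps)
    then have "Re ((of_real q * (z + h) - m) * cnj \<delta>) =
        Re ((of_real q * (z + h) - l) * cnj \<delta>) - (cmod \<delta>)\<^sup>2"
      by (simp only: minus_complex.sel Re_complex_of_real)
    ultimately show ?thesis unfolding f_def by linarith
  qed
  define \<eta> where "\<eta> = e / (2 * cmod \<delta>)"
  have "\<eta> > 0" using d e by (simp add: \<eta>_def)
  then have "cmod (of_real \<eta> * \<delta>) = \<eta> * cmod \<delta>" by (simp add: norm_mult)
  also have "\<dots> < e" using d e by (simp add: \<eta>_def)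
  finally have "cmod (of_real \<eta> * \<delta>) < e" .
  then have "f (of_real \<eta> * \<delta>) = f 0" using f[of 0] f e by simp
  moreover have "(of_real q * (z + of_real \<eta> * \<delta>) - l) * cnj \<delta> =
      (of_real q * (z + 0) - l) * cnj \<delta> + of_real (q * \<eta> * (cmod \<delta>)\<^sup>2)"
    unfolding of_real_mult complex_norm_square by (simp add: algebra_simps)
  then have "f (of_real \<eta> * \<delta>) = f 0 + 2 * (q * \<eta> * (cmod \<delta>)\<^sup>2)"
    unfolding f_def by (simp only: plus_complex.sel Re_complex_of_real) simp
  ultimately show False using q d \<open>\<eta> > 0\<close> by simp
qed

section \<open>Balanced residues and translates of the cells\<close>

definition half :: "nat \<Rightarrow> int" where "half p = (int p - 1) div 2"

definition residues :: "nat \<Rightarrow> (int \<times> int) set" where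
  "residues p = {- half p..half p} \<times> {- half p..half p}"

text \<open>Scaling by p turns the translations of the stabilizer into \<open>principal p\<close>, a
  sublattice of index p^2. For odd p the union takes one Voronoi cell from each residue
  class.\<close>

definition translation_domain :: "nat \<Rightarrow> (complex \<times> real) set" where
  "translation_domain p = (\<Union>(j, k)\<in>residues p. cell (real p) (of_int j + of_int k * \<omega>))"

lemma half_odd: "odd p \<Longrightarrow> int p = 2 * half p + 1"
  unfolding half_def by presburger

lemma balanced_residue:
  assumes "odd p"
  shows "\<exists>j m'. j \<in> {- half p..half p} \<and> m = j + int p * m'"
proof (intro exI conjI)
  define r where "r = (m + half p) mod int p"
  have "p > 0" using assms by (cases p) auto
  then have "0 \<le> r" "r < int p" by (simp_all add: r_def)
  then show "r - half p \<in> {- half p..half p}" using half_odd[OF assms] by simp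
  show "m = (r - half p) + int p * ((m + half p) div int p)"
    using mod_mult_div_eq[of "m + half p" "int p"] unfolding r_def by linarith
qed

lemma residue_unique:
  assumes "odd p" "j \<in> {- half p..half p}" "j' \<in> {- half p..half p}" "j = j' + int p * m"
  shows "m = 0"
proof (rule ccontr)
  assume "m \<noteq> 0"
  then have "int p * 1 \<le> int p * \<bar>m\<bar>" by (intro mult_left_mono) auto
  also have "\<dots> = \<bar>j - j'\<bar>" using assms(4) by (simp add: abs_mult)
  finally show False using assms(2,3) half_odd[OF assms(1)] by auto
qed

lemma cell_translation: "(\<lambda>x. (b, 0) + x) ` cell q l = cell q (l + of_real q * b)"
proof (intro equalityI subsetI)
  fix x assume "x \<in> cell q (l + of_real q * b)"
  then have "x - (b, 0) \<in> cell q l" "x = (b, 0) + (x - (b, 0))"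
    by (auto simp: cell_def algebra_simps)
  then show "x \<in> (\<lambda>x. (b, 0) + x) ` cell q l" by blast
qed (auto simp: cell_def algebra_simps)

lemma finite_residues: "finite (residues p)"
  by (simp add: residues_def)

text \<open>An overlap is open and covered by cells of both unions, so it can be shrunk twice to lie
  in one cell of each. \<open>cells_overlap\<close> identifies the two centres; being balanced
  residues up to p b, they force b = 0.\<close>

lemma translation_domain_translates_disjoint:
  assumes p: "odd p" and b: "b \<in> carrier O11" "b \<noteq> 0"
  shows "(\<lambda>x. (b, 0) + x) ` interior (translation_domain p) \<inter> interior (translation_domain p) = {}"
proof (rule ccontr)
  let ?T = "\<lambda>x :: complex \<times> real. (b, 0) + x"
  define V where "V = ?T ` interior (translation_domain p) \<inter> interior (translation_domain p)"
  assume "?T ` interior (translation_domain p) \<inter> interior (translation_domain p) \<noteq> {}"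
  then have "V \<noteq> {}" by (simp add: V_def)
  have q: "real p > 0" using p by (cases p) auto
  have meets: "\<exists>r\<in>R. W \<inter> interior (cell (real p) (c r)) \<noteq> {}"
    if W: "open W" "W \<noteq> {}" "W \<subseteq> (\<Union>r\<in>R. cell (real p) (c r))" for W R and c :: "int \<times> int \<Rightarrow> complex"
  proof -
    obtain x r where x: "x \<in> W" "r \<in> R" "x \<in> cell (real p) (c r)" using W by blast
    then have "x \<in> closure (interior (cell (real p) (c r)))" using cell_closure[OF q] by blast
    then have "W \<inter> interior (cell (real p) (c r)) \<noteq> {}"
      using x(1) open_Int_closure_eq_empty[OF W(1)] by blast
    then show ?thesis using x(2) by blast
  qed
  define c where "c r = of_int (fst r) + of_int (snd r) * \<omega>" for r :: "int \<times> int"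
  have D: "translation_domain p = (\<Union>r\<in>residues p. cell (real p) (c r))"
    unfolding translation_domain_def c_def split_beta ..
  have TD: "?T ` translation_domain p = (\<Union>r\<in>residues p. cell (real p) (c r + of_real (real p) * b))"
    unfolding D image_UN cell_translation ..
  have "open V" unfolding V_def by (intro open_Int open_translation open_interior)
  moreover have "V \<subseteq> translation_domain p" "V \<subseteq> ?T ` translation_domain p"
    unfolding V_def using interior_subset by blast+
  ultimately obtain r where r: "r \<in> residues p" "V \<inter> interior (cell (real p) (c r)) \<noteq> {}"
    using meets[where W = V and R = "residues p" and c = c] \<open>V \<noteq> {}\<close> unfolding D by blast
  define W where "W = V \<inter> interior (cell (real p) (c r))"
  have W: "open W" "W \<noteq> {}" unfolding W_def using r(2) \<open>open V\<close> by auto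
  moreover have "W \<subseteq> (\<Union>r\<in>residues p. cell (real p) (c r + of_real (real p) * b))"
    using \<open>V \<subseteq> ?T ` translation_domain p\<close> unfolding W_def TD by blast
  ultimately obtain r' where r': "r' \<in> residues p"
    "W \<inter> interior (cell (real p) (c r' + of_real (real p) * b)) \<noteq> {}"
    using meets[where W = W and R = "residues p" and c = "\<lambda>r. c r + of_real (real p) * b"] by blast
  have cO: "c r \<in> carrier O11" for r unfolding c_def O11_iff by blast
  have "c r' + of_real (real p) * b \<in> carrier O11"
    using O11_add[OF cO O11_mult[OF O11_int[of "int p"] b(1)]] by simp
  then have eq: "c r = c r' + of_real (real p) * b"
    using cO cells_overlap[OF q, of "c r" "c r' + of_real (real p) * b"
        "W \<inter> interior (cell (real p) (c r' + of_real (real p) * b))"]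
      W(1) r'(2) interior_subset unfolding W_def by blast
  obtain m n where mn: "b = of_int m + of_int n * \<omega>" using b(1) by (auto simp: O11_iff)
  have "c r' + of_real (real p) * b =
      of_int (fst r' + int p * m) + of_int (snd r' + int p * n) * \<omega>"
    by (simp add: c_def mn algebra_simps)
  then have "fst r = fst r' + int p * m" "snd r = snd r' + int p * n"
    using eq unfolding c_def O11_eq_iff[symmetric] using O11_eq_iff by metis+
  then have "m = 0" "n = 0" using residue_unique[OF p] r(1) r'(1) by (auto simp: residues_def)
  then show False using b(2) mn by simp
qed

lemma fundamental_domain_translations:
  assumes p: "odd p"
  shows "fundamental_domain (stab_inf (PGamma0 p)) (translation_domain p)"
  unfolding fundamental_domain_def
proof (intro conjI ballI impI)
  show sub: "translation_domain p \<subseteq> H3"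
    unfolding translation_domain_def cell_def H3_def by auto
  show "closedin (top_of_set H3) (translation_domain p)"
    unfolding translation_domain_def split_beta
    by (intro closedin_Union finite_imageI finite_residues) (auto intro: closedin_cell)
  have act: "\<exists>b\<in>carrier O11. g = psl_of (mat2 1 b 0 1) \<and> psl_act g = (\<lambda>x. (b, 0) + x)"
    if "g \<in> stab_inf (PGamma0 p)" for g
    using that unfolding stab_inf_PGamma0 by (auto simp: psl_act_translation)
  show "(\<Union>g\<in>stab_inf (PGamma0 p). psl_act g ` translation_domain p) = H3"
  proof (intro equalityI subsetI)
    fix x assume "x \<in> (\<Union>g\<in>stab_inf (PGamma0 p). psl_act g ` translation_domain p)"
    then obtain b y where "y \<in> translation_domain p" "x = (b, 0) + y" using act by fastforce
    then show "x \<in> H3" using sub by (auto simp: H3_def)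
  next
    fix x assume x: "x \<in> H3"
    obtain z t where zt: "x = (z, t)" by (cases x)
    obtain l where l: "l \<in> carrier O11" "of_nat p * z - l \<in> hex 1" using hex_tiling by blast
    obtain M N where MN: "l = of_int M + of_int N * \<omega>" using l by (auto simp: O11_iff)
    obtain j M' k N' where jk: "j \<in> {- half p..half p}" "M = j + int p * M'"
      "k \<in> {- half p..half p}" "N = k + int p * N'"
      using balanced_residue[OF p, of M] balanced_residue[OF p, of N] by blast
    \<comment> \<open>The part of the lattice point l that is divisible by p; subtracting it leaves
      the balanced residue (j, k).\<close>
    define b where "b = of_int M' + of_int N' * \<omega>"
    have "of_nat p * (z - b) - (of_int j + of_int k * \<omega>) = of_nat p * z - l"
      unfolding MN jk b_def by (simp add: algebra_simps)
    then have "(z - b, t) \<in> cell (real p) (of_int j + of_int k * \<omega>)"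
      using l(2) x zt by (simp add: cell_def H3_def)
    then have "(z - b, t) \<in> translation_domain p"
      unfolding translation_domain_def residues_def using jk by blast
    moreover have "x = (b, 0) + (z - b, t)" by (simp add: zt)
    ultimately have "x \<in> psl_act (psl_of (mat2 1 b 0 1)) ` translation_domain p"
      unfolding psl_act_translation by blast
    moreover have "b \<in> carrier O11" unfolding b_def O11_iff by blast
    ultimately show "x \<in> (\<Union>g\<in>stab_inf (PGamma0 p). psl_act g ` translation_domain p)"
      unfolding stab_inf_PGamma0 by blast
  qed
  fix g assume g: "g \<in> stab_inf (PGamma0 p)" "g \<noteq> psl_one"
  then obtain b where b: "b \<in> carrier O11" "g = psl_of (mat2 1 b 0 1)" "psl_act g = (\<lambda>x. (b, 0) + x)"
    using act by blast
  have "b \<noteq> 0"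
  proof
    assume "b = 0"
    then have "mat2 1 b 0 1 = mat 1" by (intro mat2_eqI) (simp_all add: mat_def)
    then have "g = psl_one" unfolding b(2) by (subst psl_of_eq_one_iff) simp_all
    then show False using g by simp
  qed
  then show "psl_act g ` interior (translation_domain p) \<inter> interior (translation_domain p) = {}"
    unfolding b(3) by (rule translation_domain_translates_disjoint[OF p b(1)])
next
  have "frontier (translation_domain p) \<subseteq>
      (\<Union>C\<in>(\<lambda>(j, k). cell (real p) (of_int j + of_int k * \<omega>)) ` residues p. frontier C)"
    unfolding translation_domain_def by (intro frontier_Union_subset finite_imageI finite_residues)
  moreover have "negligible (\<Union>C\<in>(\<lambda>(j, k). cell (real p) (of_int j + of_int k * \<omega>)) ` residues p. frontier C)"
    by (intro negligible_Union finite_imageI finite_residues)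
      (auto intro: negligible_convex_frontier convex_cell)
  ultimately show "negligible (H3 \<inter> frontier (translation_domain p))"
    by (meson inf.coboundedI2 negligible_subset)
qed

section \<open>The Ford domain\<close>

lemma exterior_Int_prism:
  assumes p: "prime p" "inert p" and l: "l \<in> carrier O11 - principal p"
    and "hexagon_hull (real p) h"
  shows "exterior (isometric_spheres (PGamma0 p)) \<inter> cell (real p) l = hexagon_hull.prism (real p) l"
proof -
  interpret hexagon_hull "real p" h l by fact
  have p1: "p > 1" "p > 0" using p prime_gt_1_nat prime_gt_0_nat by auto
  show ?thesis
  proof (intro equalityI subsetI)
    fix x assume x: "x \<in> exterior (isometric_spheres (PGamma0 p)) \<inter> cell (real p) l"
    obtain z t where zt: "x = (z, t)" by (cases x)
    have "(z, t) \<in> exterior (sphere_collection p)" using x zt exterior_eq[OF p] by simp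
    from collection_unit_sphere[OF p1(2) this l] x zt
    show "x \<in> prism" by (simp add: prism_def cell_def)
  next
    fix x assume x: "x \<in> prism"
    obtain z t where zt: "x = (z, t)" by (cases x)
    show "x \<in> exterior (isometric_spheres (PGamma0 p)) \<inter> cell (real p) l"
      using x l isometric_of_cell[OF p1(1), of t l z] unfolding zt by (simp add: prism_def cell_def)
  qed
qed

lemma exterior_Int_core:
  assumes p: "prime p" "inert p" and "cusp_hull (real p) h"
  shows "exterior (isometric_spheres (PGamma0 p)) \<inter> cell (real p) 0 = cusp_hull.core (real p)"
proof -
  interpret cusp_hull "real p" h by fact
  have p1: "p > 1" using p prime_gt_1_nat by auto
  have O0: "0 \<in> carrier O11" using O11_int[of 0] by simp
  have l: "0 \<in> principal p" unfolding principal_iff using O0 by (intro bexI[of _ 0]) simp_all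
  show ?thesis
  proof (intro equalityI subsetI)
    fix x assume x: "x \<in> exterior (isometric_spheres (PGamma0 p)) \<inter> cell (real p) 0"
    obtain z t where zt: "x = (z, t)" by (cases x)
    have "(z, t) \<in> exterior (sphere_collection p)" using x zt exterior_eq[OF p] by simp
    from collection_cusp_spheres[OF p1 this l] x zt
    show "x \<in> core" by (simp add: core_def cell_def)
  next
    fix x assume x: "x \<in> core"
    obtain z t where zt: "x = (z, t)" by (cases x)
    show "x \<in> exterior (isometric_spheres (PGamma0 p)) \<inter> cell (real p) 0"
      using x isometric_of_cell[OF p1, of t 0 z] O0 l unfolding zt by (simp add: core_def cell_def)
  qed
qed

text \<open>Among the balanced residues only (0, 0) is divisible by p, so the central hexagon alone
  has a cusp below it.\<close>

lemma nonzero_residue_notin_principal: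
  assumes p: "odd p" and jk: "(j, k) \<in> residues p - {(0, 0)}"
  shows "of_int j + of_int k * \<omega> \<in> carrier O11 - principal p"
proof
  show "of_int j + of_int k * \<omega> \<in> carrier O11" unfolding O11_iff by blast
  show "of_int j + of_int k * \<omega> \<notin> principal p"
  proof
    assume "of_int j + of_int k * \<omega> \<in> principal p"
    then obtain y where y: "y \<in> carrier O11" "of_int j + of_int k * \<omega> = of_nat p * y"
      unfolding principal_iff by blast
    then obtain m n where "y = of_int m + of_int n * \<omega>" by (auto simp: O11_iff)
    with y have "of_int j + of_int k * \<omega> = of_nat p * (of_int m + of_int n * \<omega>)" by simp
    also have "\<dots> = of_int (int p * m) + of_int (int p * n) * \<omega>" by (simp add: algebra_simps)
    finally have e: "j = 0 + int p * m" "k = 0 + int p * n" unfolding O11_eq_iff by simp_all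
    have h: "0 \<in> {- half p..half p}" using half_odd[OF p] by auto
    have "m = 0" "n = 0" using residue_unique[OF p _ h e(1)] residue_unique[OF p _ h e(2)] jk
      by (auto simp: residues_def)
    then show False using e jk by simp
  qed
qed

theorem mainTheorem19:
  fixes p :: nat
  assumes "prime p" and "odd p" and "inert p"
  shows "exterior (isometric_spheres (PGamma0 p)) = exterior (sphere_collection p) \<and>
    ford_domain (PGamma0 p)
      (hyp_hull ({Some (0, 0), None} \<union> hexagon_points p 0 0) \<union>
       (\<Union>(j, k) \<in> {- ((int p - 1) div 2)..(int p - 1) div 2} \<times>
                       {- ((int p - 1) div 2)..(int p - 1) div 2} - {(0, 0)}.
          hyp_hull ({None} \<union> hexagon_points p j k)))"
proof
  show "exterior (isometric_spheres (PGamma0 p)) = exterior (sphere_collection p)"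
    by (rule exterior_eq[OF assms(1,3)])
  define h where "h = sqrt (2 / (11 * (real p)\<^sup>2))"
  have p0: "real p > 0" using assms(1) by (simp add: prime_gt_0_nat)
  then have hh: "h > 0" "(real p * h)\<^sup>2 = 2 / 11" by (simp_all add: h_def power_mult_distrib)
  have hull: "hexagon_hull (real p) h" "cusp_hull (real p) h"
    using p0 hh by unfold_locales simp_all
  let ?E = "exterior (isometric_spheres (PGamma0 p))"
  have points: "hexagon_points p j k = hexagon_hull.points (real p) h (of_int j + of_int k * \<omega>)" for j k
  proof -
    have "hexagon_points p j k = (\<lambda>v. Some ((v + of_int j + of_int k * \<omega>) / of_nat p, h)) ` hex_vertices"
      unfolding hexagon_points_def hex_vertices_def h_def by blast
    then show ?thesis
      unfolding hexagon_hull.points_def[OF hull(1)] by (simp add: add.assoc)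
  qed
  have core: "hyp_hull ({Some (0, 0), None} \<union> hexagon_points p 0 0) = ?E \<inter> cell (real p) (of_int 0 + of_int 0 * \<omega>)"
    using exterior_Int_core[OF assms(1,3) hull(2)] cusp_hull.hyp_hull_core[OF hull(2)]
    unfolding points by simp
  have prism: "hyp_hull ({None} \<union> hexagon_points p j k) = ?E \<inter> cell (real p) (of_int j + of_int k * \<omega>)"
    if "(j, k) \<in> residues p - {(0, 0)}" for j k
    using exterior_Int_prism[OF assms(1,3) nonzero_residue_notin_principal[OF assms(2) that] hull(1)]
      hexagon_hull.hyp_hull_prism[OF hull(1)] unfolding points by simp
  \<comment> \<open>Splitting off the residue (0, 0), whose polyhedron has the extra cusp 0, from
    the union of all cells turns the given union into the exterior cut by one fundamental domain of
    the translations.\<close>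
  have zero: "(0, 0) \<in> residues p" using half_odd[OF assms(2)] by (simp add: residues_def)
  have "hyp_hull ({Some (0, 0), None} \<union> hexagon_points p 0 0) \<union>
       (\<Union>(j, k) \<in> residues p - {(0, 0)}. hyp_hull ({None} \<union> hexagon_points p j k)) =
      ?E \<inter> cell (real p) (of_int 0 + of_int 0 * \<omega>) \<union>
       (\<Union>(j, k) \<in> residues p - {(0, 0)}. ?E \<inter> cell (real p) (of_int j + of_int k * \<omega>))"
    unfolding core using prism by (intro arg_cong2[of _ _ _ _ "(\<union>)"] refl SUP_cong) auto
  also have "\<dots> = ?E \<inter> translation_domain p"
    using zero unfolding translation_domain_def by blast
  finally show "ford_domain (PGamma0 p)
      (hyp_hull ({Some (0, 0), None} \<union> hexagon_points p 0 0) \<union>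
       (\<Union>(j, k) \<in> {- ((int p - 1) div 2)..(int p - 1) div 2} \<times>
                       {- ((int p - 1) div 2)..(int p - 1) div 2} - {(0, 0)}.
          hyp_hull ({None} \<union> hexagon_points p j k)))"
    unfolding ford_domain_def residues_def half_def
    using fundamental_domain_translations[OF assms(2)] by blast
qed

end
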